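(* For any $\varepsilon>0$ there exists a nonnegative smooth function $k=k(x,y,z)$ on $\mathbb{R}^2\times\mathbb{R}$ which, as a function of $(x,y)$ for each fixed $z$, is not identically zero on any horizontal segment in $\mathbb{R}^2$ (moreover $k>0$ unless $x=z=0$), and such that for any bounded neighborhood $\Omega\subset\mathbb{R}^2$ of the origin: there is a constant $C$ with $$|\partial_zk(x,y,z)|\le C\,[k(x,y,z)]^{1-\varepsilon}\quad\text{in }\Omega\times\mathbb{R},$$ and there is a continuous weak solution $w$ in $\Omega$ of $$\partial_x^2w+\partial_y\big(k(x,y,w(x,y))\,\partial_yw\big)=0$$ that is not smooth in $\Omega$.
   Context: A horizontal segment is a nondegenerate segment parallel to the $x$-axis. Weak solutions. Write $x_1=x$, $x_2=y$, $k^1\equiv1$, $k^2=k$, and $X_i=\sqrt{k^i(x,y,0)}\,\partial_i$, $i=1,2$. $\mathrm{Lip}_0(\Omega)$ denotes Lipschitz functions with compact support in $\Omega$. A locally integrable $g$ is the weak derivative $X_iw$ of a locally integrable $w$ if $\int_\Omega g\varphi=-\int_\Omega w\,\partial_i(\sqrt{k^i(x,y,0)}\,\varphi)$ for all $\varphi\in\mathrm{Lip}_0(\Omega)$. A weak solution is a function $w\in L^2(\Omega)\cap L^\infty_{\rm loc}(\Omega)$ with $X_1w,X_2w\in L^2(\Omega)$ such that, with $\mathcal{A}=\mathrm{diag}(1,k)$ and $\nabla w$ a measurable vector field satisfying $\sqrt{k^i(x,y,0)}(\nabla w)_i=X_iw$ a.e., the function $(\nabla u)^t\mathcal{A}(x,y,w)\nabla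 w$ is integrable and $\int_\Omega(\nabla u)^t\mathcal{A}(x,y,w)\nabla w\,dx\,dy=0$ for all $u\in\mathrm{Lip}_0(\Omega)$. *)

theory Defs
  imports "HOL-Analysis.Analysis"
begin

text \<open>\<open>Ck_on n S f\<close>: \<open>f\<close> is of class $C^n$ on \<open>S\<close>. It is meant for open \<open>S\<close> in a
  finite-dimensional space, where continuity of all iterated directional derivatives is the
  usual notion.\<close>

primrec Ck_on :: "nat \<Rightarrow> 'a::real_normed_vector set \<Rightarrow> ('a \<Rightarrow> 'b::real_normed_vector) \<Rightarrow> bool" where
  "Ck_on 0 S f \<longleftrightarrow> continuous_on S f"
| "Ck_on (Suc n) S f \<longleftrightarrow> (\<forall>x\<in>S. f differentiable (at x)) \<and>
     (\<forall>v. Ck_on n S (\<lambda>x. frechet_derivative f (at x) v))"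

definition smooth_on :: "'a::real_normed_vector set \<Rightarrow> ('a \<Rightarrow> 'b::real_normed_vector) \<Rightarrow> bool" where
  "smooth_on S f \<longleftrightarrow> (\<forall>n. Ck_on n S f)"

text \<open>Elements of $\mathrm{Lip}_0(\Omega)$ are represented by their extension by zero to the plane,
  which is again Lipschitz when \<open>\<Omega>\<close> is open.\<close>

definition Lip0 :: "(real \<times> real) set \<Rightarrow> (real \<times> real \<Rightarrow> real) set" where
  "Lip0 \<Omega> = {\<phi>. (\<exists>L. L-lipschitz_on UNIV \<phi>) \<and>
     compact (closure {p. \<phi> p \<noteq> 0}) \<and> closure {p. \<phi> p \<noteq> 0} \<subseteq> \<Omega>}"

text \<open>The classical partial derivative. For a Lipschitz function it exists almost everywhere; the
  unspecified value of \<open>deriv\<close> elsewhere is irrelevant, since these derivatives only occur under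
  integrals over the complete Lebesgue measure.\<close>

definition partial_x :: "(real \<times> real \<Rightarrow> real) \<Rightarrow> real \<times> real \<Rightarrow> real" where
  "partial_x f = (\<lambda>(x, y). deriv (\<lambda>t. f (t, y)) x)"

definition partial_y :: "(real \<times> real \<Rightarrow> real) \<Rightarrow> real \<times> real \<Rightarrow> real" where
  "partial_y f = (\<lambda>(x, y). deriv (\<lambda>t. f (x, t)) y)"

definition locally_integrable :: "(real \<times> real) set \<Rightarrow> (real \<times> real \<Rightarrow> real) \<Rightarrow> bool" where
  "locally_integrable \<Omega> f \<longleftrightarrow>
     (\<forall>K. compact K \<and> K \<subseteq> \<Omega> \<longrightarrow> integrable (lebesgue_on K) f)"

definition L2_on :: "(real \<times> real) set \<Rightarrow> (real \<times> real \<Rightarrow> real) \<Rightarrow> bool" where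
  "L2_on \<Omega> f \<longleftrightarrow> f \<in> borel_measurable (lebesgue_on \<Omega>) \<and>
     integrable (lebesgue_on \<Omega>) (\<lambda>p. (f p)\<^sup>2)"

definition Linf_loc_on :: "(real \<times> real) set \<Rightarrow> (real \<times> real \<Rightarrow> real) \<Rightarrow> bool" where
  "Linf_loc_on \<Omega> f \<longleftrightarrow> f \<in> borel_measurable (lebesgue_on \<Omega>) \<and>
     (\<forall>K. compact K \<and> K \<subseteq> \<Omega> \<longrightarrow> (\<exists>M. AE p in lebesgue_on K. \<bar>f p\<bar> \<le> M))"

text \<open>\<open>g\<close> is the weak derivative \<open>a \<cdot> D w\<close> of \<open>w\<close>, where \<open>D\<close> is \<open>partial_x\<close> or \<open>partial_y\<close> and
  the coefficient \<open>a\<close> is locally Lipschitz, e.g. the square root of a nonnegative smooth function.\<close>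

definition is_weak_derivative ::
  "(real \<times> real) set \<Rightarrow> ((real \<times> real \<Rightarrow> real) \<Rightarrow> real \<times> real \<Rightarrow> real) \<Rightarrow> (real \<times> real \<Rightarrow> real)
     \<Rightarrow> (real \<times> real \<Rightarrow> real) \<Rightarrow> (real \<times> real \<Rightarrow> real) \<Rightarrow> bool" where
  "is_weak_derivative \<Omega> D a w g \<longleftrightarrow> locally_integrable \<Omega> w \<and> locally_integrable \<Omega> g \<and>
     (\<forall>\<phi>\<in>Lip0 \<Omega>. (LINT p|lebesgue_on \<Omega>. g p * \<phi> p) =
        - (LINT p|lebesgue_on \<Omega>. w p * D (\<lambda>q. a q * \<phi> q) p))"

text \<open>Weak solutions of $\partial_x^2 w + \partial_y(k(x,y,w)\,\partial_y w) = 0$ in \<open>\<Omega>\<close>. Here \<open>g1\<close> and \<open>g2\<close>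
  are $X_1 w$ and $X_2 w$, and \<open>v\<close> is the field $\nabla w$; where $k(x,y,0) > 0$ almost everywhere,
  \<open>v\<close> is determined by \<open>w\<close> up to a null set.\<close>

definition weak_solution ::
  "(real \<times> real) set \<Rightarrow> (real \<Rightarrow> real \<Rightarrow> real \<Rightarrow> real) \<Rightarrow> (real \<times> real \<Rightarrow> real) \<Rightarrow> bool" where
  "weak_solution \<Omega> k w \<longleftrightarrow> L2_on \<Omega> w \<and> Linf_loc_on \<Omega> w \<and>
     (\<exists>g1 g2 (v :: real \<times> real \<Rightarrow> real \<times> real).
        is_weak_derivative \<Omega> partial_x (\<lambda>(x, y). sqrt 1) w g1 \<and>
        is_weak_derivative \<Omega> partial_y (\<lambda>(x, y). sqrt (k x y 0)) w g2 \<and>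
        L2_on \<Omega> g1 \<and> L2_on \<Omega> g2 \<and>
        v \<in> borel_measurable (lebesgue_on \<Omega>) \<and>
        (AE (x, y) in lebesgue_on \<Omega>. sqrt 1 * fst (v (x, y)) = g1 (x, y) \<and>
           sqrt (k x y 0) * snd (v (x, y)) = g2 (x, y)) \<and>
        (\<forall>u\<in>Lip0 \<Omega>.
           integrable (lebesgue_on \<Omega>) (\<lambda>(x, y). partial_x u (x, y) * fst (v (x, y)) +
             partial_y u (x, y) * k x y (w (x, y)) * snd (v (x, y))) \<and>
           (LINT (x, y)|lebesgue_on \<Omega>. partial_x u (x, y) * fst (v (x, y)) +
             partial_y u (x, y) * k x y (w (x, y)) * snd (v (x, y))) = 0))"

end

theory Submission
  imports Defs
begin

text \<open>The solution is a partial Legendre transform of a convex function, and \<open>k\<close> is the Hessian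
  determinant of that function.

  Let \<open>\<Phi>(x,z)\<close> be convex and let \<open>w(x,y)\<close> solve \<open>\<Phi>\<^sub>z(x, w(x,y)) = y\<close>. With \<open>\<psi>(x,y) = -\<Phi>\<^sub>x(x, w(x,y))\<close>
  the chain rule gives \<open>\<psi>\<^sub>y = -\<Phi>\<^sub>x\<^sub>z/\<Phi>\<^sub>z\<^sub>z = w\<^sub>x\<close> and \<open>\<psi>\<^sub>x = -(\<Phi>\<^sub>x\<^sub>x \<Phi>\<^sub>z\<^sub>z - \<Phi>\<^sub>x\<^sub>z\<^sup>2)/\<Phi>\<^sub>z\<^sub>z = -k(x,w) w\<^sub>y\<close> for
  \<open>k = det D\<^sup>2\<Phi>\<close>. So the equation \<open>w\<^sub>x\<^sub>x + (k w\<^sub>y)\<^sub>y = 0\<close> says no more than that the mixed derivatives of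
  the stream function \<open>\<psi>\<close> agree. The radial choice \<open>\<Phi> = F(s)/2\<close> with \<open>s = x\<^sup>2 + z\<^sup>2\<close>, \<open>F'(s) = t\<^sup>n\<close> and
  \<open>t = s/(1+s)\<close> leads to \<open>k = t\<^bsup>2n\<^esup> (1 + 2n(1-t))\<close> and to \<open>w\<close> solving \<open>w t\<^sup>n = y\<close>. This \<open>k\<close> is a smooth
  function vanishing only where \<open>x = z = 0\<close>, comparable to \<open>t\<^bsup>2n\<^esup>\<close>, while \<open>\<bar>k\<^sub>z\<bar>\<close> is at most a multiple of
  \<open>t\<^bsup>2n-1/2\<^esup>\<close>; hence \<open>4n\<epsilon> \<ge> 1\<close> suffices for the bound by \<open>k\<^bsup>1-\<epsilon>\<^esup>\<close> (\<open>coeff_deriv_powr\<close>). And \<open>w\<close> is not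
  differentiable at the origin, because \<open>w(0,\<cdot>)\<close> inverts the function \<open>z \<mapsto> z t\<^sup>n\<close>, whose derivative
  vanishes at \<open>0\<close> (\<open>not_smooth_sol\<close>).

  Away from the origin \<open>w\<close> is differentiable by the inverse function theorem. The origin is removable for
  the weak formulation because \<open>w\<^sub>x\<close>, \<open>k(x,w) w\<^sub>y\<close> and \<open>\<surd>k(x,0) w\<^sub>y\<close> are bounded, so that \<open>w\<close> and \<open>\<psi>\<close> satisfy
  the Lipschitz estimates along the axes that the integrations by parts require
  (\<open>bounded_dquot_lipschitz\<close>, \<open>weak_solution_sol\<close>).

  The test functions are merely Lipschitz, so one needs that their partial derivatives exist almost
  everywhere (\<open>lipschitz_AE_dquot_converges\<close>). Integrals are then treated by difference quotients: a
  shift of variables moves a difference quotient from one factor to the other, and dominated convergence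
  gives \<open>\<integral>u\<^sub>e f = -\<integral>u f\<^sub>e\<close> and \<open>\<integral>u\<^sub>x \<psi>\<^sub>y = \<integral>u\<^sub>y \<psi>\<^sub>x\<close>, the latter for \<open>\<psi>\<close> with first derivatives only.\<close>

section \<open>Lipschitz functions have partial derivatives almost everywhere\<close>

definition dquot :: "('a::real_normed_vector \<Rightarrow> real) \<Rightarrow> 'a \<Rightarrow> 'a \<Rightarrow> real \<Rightarrow> real" where
  "dquot f e x h = (f (x + h *\<^sub>R e) - f x) / h"

text \<open>Bounded difference quotients that do not converge have lower and upper limits separated by two
  rationals \<open>p < q\<close>, so the points without derivative are covered by countably many of these sets. Strict
  inequalities at the countably many scales \<open>1/(n+1)\<close> make each a \<open>G\<^sub>\<delta>\<close> set when \<open>f\<close> is continuous.\<close>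

definition osc_set :: "('a::real_normed_vector \<Rightarrow> real) \<Rightarrow> 'a \<Rightarrow> real \<Rightarrow> real \<Rightarrow> 'a set" where
  "osc_set f e p q = {x. \<forall>n::nat. (\<exists>h. 0 < \<bar>h\<bar> \<and> \<bar>h\<bar> < 1 / Suc n \<and> dquot f e x h < p) \<and>
                                 (\<exists>h. 0 < \<bar>h\<bar> \<and> \<bar>h\<bar> < 1 / Suc n \<and> q < dquot f e x h)}"

lemma continuous_on_dquot:
  assumes "continuous_on UNIV f"
  shows "continuous_on UNIV (\<lambda>x. dquot f e x h)"
proof -
  have "continuous_on UNIV (\<lambda>x. f (x + h *\<^sub>R e))"
    by (rule continuous_on_compose2[OF assms]) (auto intro!: continuous_intros)
  then show ?thesis unfolding dquot_def divide_inverse using assms by (intro continuous_intros)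
qed

lemma borel_osc_set:
  assumes "continuous_on UNIV f"
  shows "osc_set f e p q \<in> sets borel"
proof -
  have *: "open {x. \<exists>h. 0 < \<bar>h\<bar> \<and> \<bar>h\<bar> < 1 / real (Suc n) \<and> dquot f e x h < p}"
          "open {x. \<exists>h. 0 < \<bar>h\<bar> \<and> \<bar>h\<bar> < 1 / real (Suc n) \<and> q < dquot f e x h}" for n
    by (auto intro!: open_Collect_ex open_Collect_conj open_Collect_less continuous_on_dquot assms)
  have "osc_set f e p q = (\<Inter>n. {x. \<exists>h. 0 < \<bar>h\<bar> \<and> \<bar>h\<bar> < 1 / real (Suc n) \<and> dquot f e x h < p}
      \<inter> {x. \<exists>h. 0 < \<bar>h\<bar> \<and> \<bar>h\<bar> < 1 / real (Suc n) \<and> q < dquot f e x h})"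
    unfolding osc_set_def by blast
  also have "\<dots> \<in> sets borel"
    using * by (intro sets.countable_INT') (auto intro!: borel_open)
  finally show ?thesis .
qed

text \<open>By Vitali's theorem almost all of \<open>E\<close> is covered by disjoint intervals of small slope inside an open
  set \<open>G\<close> that is hardly larger than \<open>E\<close>. Each of them is stretched at most by the factor \<open>p\<close>, and the
  exceptional null set has a null image because \<open>f\<close> is Lipschitz.\<close>

lemma emeasure_image_le_slope:
  fixes f :: "real \<Rightarrow> real"
  assumes mono: "strict_mono f" and lip: "L-lipschitz_on UNIV f"
    and E: "E \<in> sets lebesgue" and p: "0 \<le> p"
    and slope: "\<And>x d. x \<in> E \<Longrightarrow> 0 < d \<Longrightarrow>
      \<exists>a b. a \<le> x \<and> x \<le> b \<and> a < b \<and> b - a < d \<and> f b - f a \<le> p * (b - a)"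
  shows "emeasure lebesgue (f ` E) \<le> ennreal p * emeasure lebesgue E"
proof (rule ennreal_le_epsilon)
  fix e :: real assume e: "0 < e"
  obtain G where G: "open G" "E \<subseteq> G" "G - E \<in> lmeasurable"
      "emeasure lebesgue (G - E) < ennreal (e / (p + 1))"
    using sets_lebesgue_outer_open[OF E, of "e / (p + 1)"] e p by auto
  define K where "K = {(a, b). a < b \<and> {a..b} \<subseteq> G \<and> f b - f a \<le> p * (b - a)}"
  define c where "c = (\<lambda>(a::real, b::real). (a + b) / 2)"
  define r where "r = (\<lambda>(a::real, b::real). (b - a) / 2)"
  have cb: "cball (c i) (r i) = {fst i..snd i}" for i
    by (auto simp: c_def r_def case_prod_beta cball_eq_atLeastAtMost field_simps)
  have ex: "\<exists>i. i \<in> K \<and> x \<in> cball (c i) (r i) \<and> r i < d" if "x \<in> E" "0 < d" for x d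
  proof -
    obtain \<delta> where \<delta>: "\<delta> > 0" "ball x \<delta> \<subseteq> G"
      using G \<open>x \<in> E\<close> open_contains_ball by blast
    obtain a b where ab: "a \<le> x" "x \<le> b" "a < b" "b - a < min d \<delta>" "f b - f a \<le> p * (b - a)"
      using slope[OF \<open>x \<in> E\<close>, of "min d \<delta>"] \<delta> \<open>0 < d\<close> by auto
    have "{a..b} \<subseteq> ball x \<delta>" using ab by (auto simp: dist_real_def)
    then have "(a, b) \<in> K" using ab \<delta> by (auto simp: K_def)
    moreover have "x \<in> cball (c (a, b)) (r (a, b))" unfolding cb using ab by auto
    moreover have "r (a, b) < d" using ab by (auto simp: r_def)
    ultimately show ?thesis by blast
  qed
  have r: "\<And>i. i \<in> K \<Longrightarrow> 0 < r i" by (auto simp: K_def r_def)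
  obtain C where C: "countable C" "C \<subseteq> K"
     "pairwise (\<lambda>i j. disjnt (cball (c i) (r i)) (cball (c j) (r j))) C"
     "negligible (E - (\<Union>i \<in> C. cball (c i) (r i)))"
    using Vitali_covering_theorem_cballs[of K r E c, OF r ex] by blast
  define J where "J = (\<lambda>i::real\<times>real. {fst i..snd i})"
  have disj: "disjoint_family_on J C"
    using C(3) unfolding cb J_def disjoint_family_on_def pairwise_def disjnt_def by blast
  have fJ: "f ` J i \<subseteq> {f (fst i)..f (snd i)}" for i
    using strict_mono_mono[OF mono] by (auto simp: J_def mono_def)
  have cont: "continuous_on S f" for S
    using lipschitz_on_continuous_on[OF lip] continuous_on_subset by blast
  have fJm: "f ` J i \<in> sets lebesgue" for i
    using compact_continuous_image[OF cont, of "J i"] by (auto simp: J_def compact_imp_closed)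
  have injf: "inj f" using mono strict_mono_imp_inj_on by blast
  have disjf: "disjoint_family_on (\<lambda>i. f ` J i) C"
    using disj injf unfolding disjoint_family_on_def
    by (metis image_Int image_is_empty)
  have "negligible (f ` (E - (\<Union>i \<in> C. J i)))"
  proof (rule negligible_locally_Lipschitz_image)
    show "negligible (E - (\<Union>i \<in> C. J i))" using C(4) unfolding cb J_def .
    show "\<exists>T B. open T \<and> x \<in> T \<and> (\<forall>y\<in>(E - (\<Union>i \<in> C. J i)) \<inter> T. norm (f y - f x) \<le> B * norm (y - x))" for x
      using lipschitz_onD[OF lip, of _ x] by (intro exI[of _ UNIV] exI[of _ L]) (auto simp: dist_norm)
  qed auto
  then have n0: "f ` (E - (\<Union>i \<in> C. J i)) \<in> null_sets lebesgue"
    by (simp add: negligible_iff_null_sets)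
  have UfJ: "(\<Union>i\<in>C. f ` J i) \<in> sets lebesgue"
    using C(1) fJm by (intro sets.countable_UN') auto
  have UJG: "(\<Union>i\<in>C. J i) \<subseteq> G" using C(2) by (fastforce simp: K_def J_def)
  have "emeasure lebesgue (f ` E) \<le> emeasure lebesgue (f ` (E - (\<Union>i \<in> C. J i)) \<union> (\<Union>i\<in>C. f ` J i))"
    using UfJ n0 by (intro emeasure_mono) auto
  also have "\<dots> = emeasure lebesgue (\<Union>i\<in>C. f ` J i)"
    using emeasure_Un_null_set[OF UfJ n0] by (simp add: Un_commute)
  also have "\<dots> = (\<integral>\<^sup>+i. emeasure lebesgue (f ` J i) \<partial>count_space C)"
    using fJm C(1) disjf by (intro emeasure_UN_countable) auto
  also have "\<dots> \<le> (\<integral>\<^sup>+i. ennreal p * emeasure lebesgue (J i) \<partial>count_space C)"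
  proof (rule nn_integral_mono)
    fix i assume "i \<in> space (count_space C)"
    then have i: "fst i < snd i" "f (snd i) - f (fst i) \<le> p * (snd i - fst i)"
      using C(2) by (auto simp: K_def)
    have "f (fst i) < f (snd i)" using i(1) mono by (simp add: strict_mono_def)
    then have "emeasure lebesgue (f ` J i) \<le> ennreal (f (snd i) - f (fst i))"
      using emeasure_mono[OF fJ[of i], of lebesgue] by simp
    also have "\<dots> \<le> ennreal (p * (snd i - fst i))" using i(2) by (rule ennreal_leI)
    also have "\<dots> = ennreal p * emeasure lebesgue (J i)"
      using i(1) p by (simp add: J_def ennreal_mult)
    finally show "emeasure lebesgue (f ` J i) \<le> ennreal p * emeasure lebesgue (J i)" .
  qed
  also have "\<dots> = ennreal p * (\<integral>\<^sup>+i. emeasure lebesgue (J i) \<partial>count_space C)"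
    by (rule nn_integral_cmult) auto
  also have "(\<integral>\<^sup>+i. emeasure lebesgue (J i) \<partial>count_space C) = emeasure lebesgue (\<Union>i\<in>C. J i)"
    using C(1) disj by (intro emeasure_UN_countable[symmetric]) (auto simp: J_def)
  also have "ennreal p * \<dots> \<le> ennreal p * emeasure lebesgue G"
    using UJG G(1) by (intro mult_left_mono emeasure_mono) auto
  also have "emeasure lebesgue G = emeasure lebesgue E + emeasure lebesgue (G - E)"
    using G E emeasure_Un[of E lebesgue "G"] plus_emeasure[of E lebesgue "G - E"]
    by (auto simp: Un_absorb1)
  also have "ennreal p * (emeasure lebesgue E + emeasure lebesgue (G - E))
      \<le> ennreal p * (emeasure lebesgue E + ennreal (e / (p + 1)))"
    using G(4) by (intro mult_left_mono add_left_mono) auto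
  also have "\<dots> = ennreal p * emeasure lebesgue E + ennreal (p * (e / (p + 1)))"
    using p e by (simp add: distrib_left ennreal_mult[symmetric])
  also have "\<dots> \<le> ennreal p * emeasure lebesgue E + ennreal e"
    using p e by (intro add_left_mono ennreal_leI) (auto simp: field_simps)
  finally show "emeasure lebesgue (f ` E) \<le> ennreal p * emeasure lebesgue E + ennreal e" .
qed

text \<open>Adding a large linear function turns \<open>f\<close> into a bi-Lipschitz increasing map \<open>g\<close>, with \<open>p\<close> and \<open>q\<close>
  replaced by positive \<open>P < Q\<close>. On a bounded piece \<open>E\<close> of the set the slope estimate applies to \<open>g\<close> with
  \<open>P\<close> and to its inverse with \<open>1/Q\<close>. So the measure of \<open>E\<close> is at most \<open>P/Q < 1\<close> times itself.\<close>

lemma null_osc_set_real: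
  fixes f :: "real \<Rightarrow> real"
  assumes lip: "L-lipschitz_on UNIV f" and pq: "p < q"
  shows "osc_set f 1 p q \<in> null_sets lborel"
proof -
  define M where "M = L + 1"
  have M: "M > 0" using lipschitz_on_nonneg[OF lip] by (simp add: M_def)
  have fM: "\<bar>f y - f x\<bar> \<le> M * \<bar>y - x\<bar>" for x y
    using lipschitz_onD[OF lip, of y x] by (simp add: dist_real_def M_def distrib_right)
  \<comment> \<open>The slope \<open>2 M\<close> exceeds the Lipschitz constant by at least \<open>M\<close>, so all slopes of \<open>g\<close> lie in \<open>[M, 3 M]\<close>.\<close>
  define g where "g = (\<lambda>x. f x + 2 * M * x)"
  have g1: "M * (y - x) \<le> g y - g x" if "x \<le> y" for x y
    using fM[of y x] that by (simp add: g_def algebra_simps abs_le_iff)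
  have g3: "\<bar>g y - g x\<bar> \<le> 3 * M * \<bar>y - x\<bar>" for x y
  proof -
    have "g y - g x = (f y - f x) + 2 * M * (y - x)" by (simp add: g_def algebra_simps)
    then have "\<bar>g y - g x\<bar> \<le> \<bar>f y - f x\<bar> + \<bar>2 * M * (y - x)\<bar>" by linarith
    then show ?thesis using fM[of y x] M by (simp add: abs_mult)
  qed
  have glip: "(3 * M)-lipschitz_on UNIV g"
    using g3 M by (intro lipschitz_onI) (auto simp: dist_real_def)
  have gmono: "strict_mono g"
  proof (rule strict_monoI)
    fix x y :: real assume "x < y"
    then have "0 < M * (y - x)" using M by simp
    then show "g x < g y" using g1[of x y] \<open>x < y\<close> by linarith
  qed
  have contg: "continuous_on S g" for S
    using lipschitz_on_continuous_on[OF glip] continuous_on_subset by blast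
  have "surj g"
  proof -
    have "\<exists>x. g x = y" for y
    proof -
      define a where "a = \<bar>y - g 0\<bar> / M"
      have a: "a \<ge> 0" "M * a = \<bar>y - g 0\<bar>" using M by (auto simp: a_def)
      have "g (-a) \<le> y" "y \<le> g a" using g1[of "-a" 0] g1[of 0 a] a by auto
      then show ?thesis using IVT'[of g "-a" y a] a contg by auto
    qed
    then show ?thesis by (metis surj_def)
  qed
  define G where "G = inv g"
  have Gg: "G (g x) = x" for x
    unfolding G_def by (rule inv_f_f) (use gmono strict_mono_imp_inj_on in blast)
  have gG: "g (G y) = y" for y
    unfolding G_def by (rule surj_f_inv_f[OF \<open>surj g\<close>])
  have Gmono: "strict_mono G"
    using gmono gG by (metis not_less_iff_gr_or_eq strict_mono_def strict_mono_less)
  have Glip: "(1 / M)-lipschitz_on UNIV G"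
  proof (rule lipschitz_onI)
    fix x y :: real
    have "M * \<bar>G x - G y\<bar> \<le> \<bar>x - y\<bar>"
      using g1[of "G x" "G y"] g1[of "G y" "G x"] M unfolding gG by (cases "G x \<le> G y") auto
    then show "dist (G x) (G y) \<le> 1 / M * dist x y"
      using M by (simp add: dist_real_def field_simps)
  qed (use M in simp)
  have contG: "continuous_on S G" for S
    using lipschitz_on_continuous_on[OF Glip] continuous_on_subset by blast
  have contf: "continuous_on UNIV f" using lipschitz_on_continuous_on[OF lip] .
  have Eb: "osc_set f 1 p q \<in> sets borel" by (rule borel_osc_set[OF contf])
  have dq: "dquot f 1 x h * h = f (x + h) - f x" if "h \<noteq> 0" for x h
    using that by (simp add: dquot_def)
  have N0: "emeasure lborel (osc_set f 1 p q \<inter> {- real N..real N}) = 0" for N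
  proof (cases "osc_set f 1 p q = {}")
    case False
    define E where "E = osc_set f 1 p q \<inter> {- real N..real N}"
    define P where "P = p + 2 * M"
    define Q where "Q = q + 2 * M"
    have slope_ex: "\<exists>a b. a \<le> x \<and> x \<le> b \<and> a < b \<and> b - a < d \<and> g b - g a \<le> P * (b - a)"
      and slope_ex2: "\<exists>a b. a \<le> x \<and> x \<le> b \<and> a < b \<and> b - a < d \<and> g b - g a \<ge> Q * (b - a)"
      if x: "x \<in> osc_set f 1 p q" and d: "d > 0" for x d
    proof -
      obtain n :: nat where n: "1 / Suc n < d" using d by (meson nat_approx_posE)
      obtain h where h: "0 < \<bar>h\<bar>" "\<bar>h\<bar> < 1 / Suc n" "dquot f 1 x h < p"
        using x unfolding osc_set_def by blast
      obtain h' where h': "0 < \<bar>h'\<bar>" "\<bar>h'\<bar> < 1 / Suc n" "q < dquot f 1 x h'"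
        using x unfolding osc_set_def by blast
      show "\<exists>a b. a \<le> x \<and> x \<le> b \<and> a < b \<and> b - a < d \<and> g b - g a \<le> P * (b - a)"
      proof (cases "h > 0")
        case True
        then have "f (x + h) - f x \<le> p * h" 
          using h dq[of h x] mult_right_mono[of "dquot f 1 x h" p h] by auto
        then show ?thesis using True h n
          by (intro exI[of _ x] exI[of _ "x + h"]) (auto simp: g_def P_def algebra_simps)
      next
        case False
        then have "h < 0" using h by auto
        then have "f (x + h) - f x \<ge> p * h" 
          using h dq[of h x] mult_right_mono_neg[of "dquot f 1 x h" p h] by auto
        then show ?thesis using \<open>h < 0\<close> h n
          by (intro exI[of _ "x + h"] exI[of _ "x"]) (auto simp: g_def P_def algebra_simps)
      qed
      show "\<exists>a b. a \<le> x \<and> x \<le> b \<and> a < b \<and> b - a < d \<and> g b - g a \<ge> Q * (b - a)"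
      proof (cases "h' > 0")
        case True
        then have "f (x + h') - f x \<ge> q * h'" 
          using h' dq[of h' x] mult_right_mono[of q "dquot f 1 x h'" h'] by auto
        then show ?thesis using True h' n
          by (intro exI[of _ x] exI[of _ "x + h'"]) (auto simp: g_def Q_def algebra_simps)
      next
        case False
        then have "h' < 0" using h' by auto
        then have "f (x + h') - f x \<le> q * h'" 
          using h' dq[of h' x] mult_right_mono_neg[of q "dquot f 1 x h'" h'] by auto
        then show ?thesis using \<open>h' < 0\<close> h' n
          by (intro exI[of _ "x + h'"] exI[of _ "x"]) (auto simp: g_def Q_def algebra_simps)
      qed
    qed
    obtain x0 where "x0 \<in> osc_set f 1 p q" using False by auto
    from slope_ex[OF this zero_less_one] obtain a b where ab: "a < b" "g b - g a \<le> P * (b - a)" by blast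
    then have "M * (b - a) \<le> P * (b - a)" using g1[of a b] by linarith
    then have P: "P \<ge> M" "P > 0" using ab M by auto
    then have Q: "Q > P" "Q > 0" using pq by (auto simp: P_def Q_def)
    have E: "E \<in> sets borel" using Eb by (auto simp: E_def)
    have gE: "g ` E = G -` E" using Gg gG by (auto simp: image_iff) metis
    have "G \<in> borel_measurable borel" using contG by (rule borel_measurable_continuous_onI)
    then have gEb: "g ` E \<in> sets borel" unfolding gE using E measurable_sets[of G borel borel E] by simp
    have GgE: "G ` g ` E = E" using Gg by (auto simp: image_iff)
    have 1: "emeasure lebesgue (g ` E) \<le> ennreal P * emeasure lebesgue E"
      by (rule emeasure_image_le_slope[OF gmono glip]) (use E P slope_ex in \<open>auto simp: E_def\<close>)
    have 2: "emeasure lebesgue (G ` g ` E) \<le> ennreal (1 / Q) * emeasure lebesgue (g ` E)"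
    proof (rule emeasure_image_le_slope[OF Gmono Glip])
      fix y d :: real assume "y \<in> g ` E" "0 < d"
      then obtain x where x: "x \<in> osc_set f 1 p q" "y = g x" by (auto simp: E_def)
      obtain a b where ab: "a \<le> x" "x \<le> b" "a < b" "b - a < d / (3 * M)" "g b - g a \<ge> Q * (b - a)"
        using slope_ex2[OF x(1), of "d / (3 * M)"] M \<open>0 < d\<close> by auto
      have "g b - g a \<le> 3 * M * (b - a)" using g3[of b a] ab by simp
      also have "\<dots> < d" using ab M by (simp add: field_simps)
      finally have "g b - g a < d" .
      moreover have "G (g b) - G (g a) \<le> 1 / Q * (g b - g a)"
        using ab Q by (simp add: Gg field_simps)
      ultimately show "\<exists>a b. a \<le> y \<and> y \<le> b \<and> a < b \<and> b - a < d \<and> G b - G a \<le> 1 / Q * (b - a)"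
        using ab x gmono strict_mono_mono[OF gmono]
        by (intro exI[of _ "g a"] exI[of _ "g b"]) (auto simp: strict_mono_def mono_def)
    qed (use gEb Q in auto)
    have fin: "emeasure lebesgue E < \<infinity>"
    proof -
      have "emeasure lebesgue E \<le> emeasure lebesgue {- real N..real N}"
        by (rule emeasure_mono) (auto simp: E_def)
      also have "\<dots> < \<infinity>" by simp
      finally show ?thesis .
    qed
    define m where "m = enn2real (emeasure lebesgue E)"
    have m: "emeasure lebesgue E = ennreal m" "m \<ge> 0" using fin by (auto simp: m_def)
    have "ennreal m \<le> ennreal (1 / Q) * (ennreal P * ennreal m)"
      using 1 2 unfolding GgE m(1) by (meson mult_left_mono order_trans zero_le)
    also have "\<dots> = ennreal (1 / Q * (P * m))" using P Q m by (simp add: ennreal_mult[symmetric])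
    finally have "m \<le> P * m / Q" using m P Q by simp
    then have "Q * m \<le> P * m" using Q by (simp add: field_simps)
    then have "m = 0" using m(2) Q by (metis linorder_not_le mult_le_cancel_right order_antisym_conv)
    then show ?thesis using m(1) E by (simp add: E_def emeasure_completion)
  qed simp
  have "emeasure lborel (\<Union>N. osc_set f 1 p q \<inter> {- real N..real N}) = 0"
    using N0 Eb by (intro emeasure_UN_eq_0) auto
  moreover have "(\<Union>N. osc_set f 1 p q \<inter> {- real N..real N}) = osc_set f 1 p q"
  proof -
    have "\<exists>N. x \<in> {- real N..real N}" for x :: real
      using real_arch_simple[of "\<bar>x\<bar>"] by (force simp: abs_le_iff)
    then show ?thesis by auto
  qed
  ultimately show ?thesis using Eb by (auto simp: null_sets_def)
qed

lemma dquot_convergesI: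
  assumes bound: "\<And>h. h \<noteq> 0 \<Longrightarrow> \<bar>dquot f e x h\<bar> \<le> B"
    and notin: "\<And>p q :: rat. p < q \<Longrightarrow> x \<notin> osc_set f e (of_rat p) (of_rat q)"
  shows "\<exists>D. (dquot f e x \<longlongrightarrow> D) (at 0)"
proof -
  define X where "X = (\<lambda>h. ereal (dquot f e x h))"
  have "\<not> Liminf (at 0) X < Limsup (at 0) X"
  proof
    assume "Liminf (at 0) X < Limsup (at 0) X"
    then obtain p where p: "Liminf (at 0) X < ereal (real_of_rat p)" "ereal (real_of_rat p) < Limsup (at 0) X"
      using ereal_dense3 by blast
    obtain q where q: "ereal (real_of_rat p) < ereal (real_of_rat q)" "ereal (real_of_rat q) < Limsup (at 0) X"
      using ereal_dense3[OF p(2)] by blast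
    have "\<not> ereal (real_of_rat p) \<le> Liminf (at 0) X" using p by auto
    then obtain y where y: "y < ereal (real_of_rat p)" "\<not> eventually (\<lambda>h. y < X h) (at 0)"
      unfolding le_Liminf_iff by blast
    have "\<not> Limsup (at 0) X \<le> ereal (real_of_rat q)" using q by auto
    then obtain z where z: "z > ereal (real_of_rat q)" "\<not> eventually (\<lambda>h. X h < z) (at 0)"
      unfolding Limsup_le_iff by blast
    have "x \<in> osc_set f e (of_rat p) (of_rat q)"
      unfolding osc_set_def
    proof (intro CollectI allI conjI)
      fix n :: nat
      have d: "0 < 1 / real (Suc n)" by simp
      obtain h where "h \<noteq> 0" "\<bar>h\<bar> < 1 / real (Suc n)" "\<not> y < X h"
        using y(2) d unfolding eventually_at dist_real_def by (metis UNIV_I diff_0_right)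
      then show "\<exists>h. 0 < \<bar>h\<bar> \<and> \<bar>h\<bar> < 1 / real (Suc n) \<and> dquot f e x h < of_rat p"
        using y(1) order_le_less_trans[of "X h" y "ereal (of_rat p)"]
        by (intro exI[of _ h]) (auto simp: X_def not_less)
      obtain h where "h \<noteq> 0" "\<bar>h\<bar> < 1 / real (Suc n)" "\<not> X h < z"
        using z(2) d unfolding eventually_at dist_real_def by (metis UNIV_I diff_0_right)
      then show "\<exists>h. 0 < \<bar>h\<bar> \<and> \<bar>h\<bar> < 1 / real (Suc n) \<and> of_rat q < dquot f e x h"
        using z(1) order_less_le_trans[of "ereal (of_rat q)" z "X h"]
        by (intro exI[of _ h]) (auto simp: X_def not_less)
    qed
    moreover have "p < q" using q by (simp add: of_rat_less)
    ultimately show False using notin by blast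
  qed
  moreover have "Liminf (at 0) X \<le> Limsup (at 0) X" by (rule Liminf_le_Limsup) simp
  ultimately have "Liminf (at 0) X = Limsup (at 0) X" by auto
  then have lim: "(X \<longlongrightarrow> Limsup (at 0) X) (at 0)"
    by (intro Liminf_eq_Limsup) auto
  have ev: "eventually (\<lambda>h. \<bar>dquot f e x h\<bar> \<le> B) (at 0)"
    using bound by (auto simp: eventually_at intro!: exI[of _ 1])
  have "Limsup (at 0) X \<le> ereal B"
    by (rule tendsto_upperbound[OF lim]) (use ev in \<open>auto simp: X_def elim: eventually_mono\<close>)
  moreover have "ereal (-B) \<le> Limsup (at 0) X"
    by (rule tendsto_lowerbound[OF lim]) (use ev in \<open>auto simp: X_def elim!: eventually_mono\<close>)
  ultimately obtain D where "Limsup (at 0) X = ereal D"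
    by (cases "Limsup (at 0) X") auto
  then show ?thesis using lim by (auto simp: X_def)
qed

lemma abs_dquot_le:
  assumes "\<And>h. \<bar>f (x + h *\<^sub>R e) - f x\<bar> \<le> B * \<bar>h\<bar>" "h \<noteq> 0"
  shows "\<bar>dquot f e x h\<bar> \<le> B"
  using assms(1)[of h] assms(2) by (simp add: dquot_def divide_simps)

lemma lipschitz_dquot_bound:
  assumes "L-lipschitz_on UNIV f"
  shows "\<bar>f (x + h *\<^sub>R e) - f x\<bar> \<le> (L * norm e) * \<bar>h\<bar>"
  using lipschitz_onD[OF assms, of "x + h *\<^sub>R e" x] by (simp add: dist_norm mult_ac)

text \<open>By Fubini's theorem: the sections of the set along the lines in direction \<open>e\<close> are the corresponding
  sets for Lipschitz functions of one variable.\<close>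

lemma null_osc_set_plane:
  fixes u :: "real \<times> real \<Rightarrow> real"
  assumes lip: "L-lipschitz_on UNIV u" and pq: "p < q" and e: "e = (1, 0) \<or> e = (0, 1)"
  shows "osc_set u e p q \<in> null_sets lborel"
proof -
  have b: "osc_set u e p q \<in> sets (lborel \<Otimes>\<^sub>M lborel)"
    unfolding lborel_prod using borel_osc_set[OF lipschitz_on_continuous_on[OF lip]] by simp
  have 1: "L-lipschitz_on UNIV (\<lambda>x. u (x, y))" "L-lipschitz_on UNIV (\<lambda>x. u (y, x))" for y
    using lipschitz_onD[OF lip] lipschitz_on_nonneg[OF lip]
    by (auto intro!: lipschitz_onI simp: dist_Pair_Pair dest: spec)
       (metis (no_types) UNIV_I dist_Pair_Pair dist_self power_zero_numeral add_0 add_0_right real_sqrt_abs abs_of_nonneg zero_le_dist)+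
  have "emeasure (lborel \<Otimes>\<^sub>M lborel) (osc_set u e p q) = 0"
    using e
  proof
    assume e: "e = (1, 0)"
    have "(\<lambda>x. (x, y)) -` osc_set u e p q = osc_set (\<lambda>x. u (x, y)) 1 p q" for y
      by (auto simp: osc_set_def dquot_def e)
    then show ?thesis
      using null_osc_set_real[OF 1(1) pq] by (simp add: lborel_pair.emeasure_pair_measure_alt2[OF b] null_setsD1)
  next
    assume e: "e = (0, 1)"
    have "Pair x -` osc_set u e p q = osc_set (\<lambda>y. u (x, y)) 1 p q" for x
      by (auto simp: osc_set_def dquot_def e)
    then show ?thesis
      using null_osc_set_real[OF 1(2) pq] by (simp add: lborel.emeasure_pair_measure_alt[OF b] null_setsD1)
  qed
  then show ?thesis using b unfolding null_sets_def lborel_prod by simp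
qed

theorem lipschitz_AE_dquot_converges:
  fixes u :: "real \<times> real \<Rightarrow> real"
  assumes lip: "L-lipschitz_on UNIV u" and e: "e = (1, 0) \<or> e = (0, 1)"
  shows "AE x in lborel. \<exists>D. (dquot u e x \<longlongrightarrow> D) (at 0)"
proof -
  have "AE x in lborel. \<forall>pq \<in> {pq :: rat \<times> rat. fst pq < snd pq}. x \<notin> osc_set u e (of_rat (fst pq)) (of_rat (snd pq))"
    by (subst AE_ball_countable)
      (auto intro!: AE_not_in null_osc_set_plane[OF lip _ e] simp: of_rat_less)
  then show ?thesis
  proof eventually_elim
    case (elim x)
    show ?case
      by (rule dquot_convergesI[of u e x "L * norm e"])
         (use elim abs_dquot_le[OF lipschitz_dquot_bound[OF lip]] in auto)
  qed
qed

section \<open>Integration by parts against Lipschitz test functions\<close>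

lemma lborel_integral_translate:
  fixes f :: "'a::euclidean_space \<Rightarrow> real"
  assumes [measurable]: "f \<in> borel_measurable borel"
  shows "(\<integral>x. f (x + c) \<partial>lborel) = (\<integral>x. f x \<partial>lborel)"
proof -
  have "(\<integral>x. f x \<partial>lborel) = (\<integral>x. f x \<partial>distr lborel borel ((+) c))"
    by (simp add: lborel_distr_plus)
  also have "\<dots> = (\<integral>x. f (c + x) \<partial>lborel)"
    by (rule integral_distr) auto
  finally show ?thesis by (simp add: add.commute)
qed

lemma integrable_compact_support:
  fixes f :: "'a::euclidean_space \<Rightarrow> real"
  assumes "continuous_on UNIV f" "compact S" "\<And>x. x \<notin> S \<Longrightarrow> f x = 0"
  shows "integrable lborel f"
proof -
  have "integrable lborel (\<lambda>x. indicator S x *\<^sub>R f x)"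
    using assms by (intro borel_integrable_compact) (auto intro: continuous_on_subset)
  also have "(\<lambda>x. indicator S x *\<^sub>R f x) = f" using assms(3) by (intro ext) (auto simp: indicator_def)
  finally show ?thesis .
qed

lemma continuous_on_translate:
  fixes f :: "'a::real_normed_vector \<Rightarrow> real"
  assumes "continuous_on UNIV f"
  shows "continuous_on UNIV (\<lambda>x. f (x + c))"
  by (rule continuous_on_compose2[OF assms]) (auto intro!: continuous_intros)

lemma summation_by_parts:
  fixes u g :: "'a::euclidean_space \<Rightarrow> real"
  assumes u: "continuous_on UNIV u" and S: "compact S" and supp: "\<And>x. x \<notin> S \<Longrightarrow> u x = 0"
    and g: "continuous_on UNIV g"
  shows "(\<integral>x. (u (x + c) - u x) * g x \<partial>lborel) = (\<integral>x. u x * (g (x - c) - g x) \<partial>lborel)"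
proof -
  note cu = continuous_on_translate[OF u] and cg = continuous_on_translate[OF g]
  have i1: "integrable lborel (\<lambda>x. u (x + c) * g x)"
  proof (rule integrable_compact_support)
    show "compact ((\<lambda>x. x - c) ` S)"
      using S by (intro compact_continuous_image) (auto intro!: continuous_intros)
    show "u (x + c) * g x = 0" if "x \<notin> (\<lambda>x. x - c) ` S" for x
      using that supp[of "x + c"] by (force simp: image_iff)
  qed (intro continuous_intros cu g)
  have i2: "integrable lborel (\<lambda>x. u x * g x)"
    by (rule integrable_compact_support[OF _ S]) (auto intro!: continuous_intros u g simp: supp)
  have i3: "integrable lborel (\<lambda>x. u x * g (x - c))"
    using cg[of "-c"] by (intro integrable_compact_support[OF _ S]) (auto intro!: continuous_intros u simp: supp)
  have "(\<integral>x. u (x + c) * g x \<partial>lborel) = (\<integral>x. (\<lambda>x. u x * g (x - c)) (x + c) \<partial>lborel)" by simp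
  also have "\<dots> = (\<integral>x. u x * g (x - c) \<partial>lborel)"
    using cg[of "-c"] u
    by (intro lborel_integral_translate borel_measurable_continuous_onI) (auto intro!: continuous_intros)
  finally show ?thesis using i1 i2 i3 by (simp add: left_diff_distrib right_diff_distrib)
qed

text \<open>The limit is prescribed only almost everywhere, as a classical derivative of a Lipschitz function is.
  It is thus measurable for the completed measure only, and this is where the passage from \<open>lborel\<close> to
  \<open>lebesgue\<close> happens.\<close>

lemma lebesgue_limit:
  fixes s :: "nat \<Rightarrow> 'a::euclidean_space \<Rightarrow> real"
  assumes s: "\<And>m. s m \<in> borel_measurable borel"
    and lim: "AE x in lborel. (\<lambda>m. s m x) \<longlonglongrightarrow> l x"
    and S: "compact S" and bound: "\<And>m x. \<bar>s m x\<bar> \<le> B * indicator S x"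
  shows "integrable lebesgue l" "(\<lambda>m. \<integral>x. s m x \<partial>lborel) \<longlonglongrightarrow> (\<integral>x. l x \<partial>lebesgue)"
proof -
  have lim': "AE x in lebesgue. (\<lambda>m. s m x) \<longlonglongrightarrow> l x" using lim by (rule AE_completion)
  have sm: "s m \<in> borel_measurable lebesgue" for m
    using s[of m] by (simp add: measurable_completion)
  have "(\<lambda>x. lim (\<lambda>m. s m x)) \<in> borel_measurable lebesgue"
    using sm by (rule borel_measurable_lim_metric)
  then have l: "l \<in> borel_measurable lebesgue"
    by (rule borel_measurable_AE) (use lim' in \<open>auto elim!: eventually_mono simp: limI\<close>)
  have w: "integrable lebesgue (\<lambda>x. B * indicator S x :: real)"
    using S lmeasurable_compact[OF S] by (auto simp: fmeasurable_def)
  note dc = integral_dominated_convergence[OF l sm w lim']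
  have b: "AE x in lebesgue. norm (s m x) \<le> B * indicator S x" for m using bound by simp
  show "integrable lebesgue l"
    by (rule integrable_dominated_convergence[OF l sm w lim' b])
  have "(\<lambda>m. \<integral>x. s m x \<partial>lebesgue) \<longlonglongrightarrow> (\<integral>x. l x \<partial>lebesgue)"
    by (rule dc[OF b])
  then show "(\<lambda>m. \<integral>x. s m x \<partial>lborel) \<longlonglongrightarrow> (\<integral>x. l x \<partial>lebesgue)"
    using s by (simp add: integral_completion)
qed

lemma step_at_0:
  "filterlim (\<lambda>m. 1 / real (Suc m)) (at 0) sequentially"
  "filterlim (\<lambda>m. - (1 / real (Suc m))) (at 0) sequentially"
  using tendsto_minus[OF LIMSEQ_Suc[OF lim_1_over_n[where 'a = real]]] LIMSEQ_Suc[OF lim_1_over_n[where 'a = real]]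
  by (auto simp: filterlim_at)

lemma tendsto_steps:
  fixes F :: "real \<Rightarrow> real"
  assumes "(F \<longlongrightarrow> l) (at 0)"
  shows "(\<lambda>m. F (1 / real (Suc m))) \<longlonglongrightarrow> l" "(\<lambda>m. F (- (1 / real (Suc m)))) \<longlonglongrightarrow> l"
  using filterlim_compose[OF assms step_at_0(1)] filterlim_compose[OF assms step_at_0(2)] by auto

text \<open>Provides a dominating function for difference quotients: the supports stay in one compact set as long as the
  steps are at most \<open>1\<close>.\<close>

lemma dquot_supp:
  fixes u :: "'a::euclidean_space \<Rightarrow> real"
  assumes S: "compact S" and supp: "\<And>x. x \<notin> S \<Longrightarrow> u x = 0"
  obtains S' where "compact S'" "\<And>x h. \<bar>h\<bar> \<le> 1 \<Longrightarrow> x \<notin> S' \<Longrightarrow> dquot u e x h = 0"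
proof
  define S' where "S' = (\<lambda>(x, t). x - t *\<^sub>R e) ` (S \<times> {-1..1::real})"
  show "compact S'" unfolding S'_def using S
    by (intro compact_continuous_image compact_Times) (auto intro!: continuous_intros simp: case_prod_beta)
  have mem: "y - t *\<^sub>R e \<in> S'" if "y \<in> S" "\<bar>t\<bar> \<le> 1" for y t
    using that by (force simp: S'_def)
  have sub: "S \<subseteq> S'" using mem[of _ 0] by auto
  show "dquot u e x h = 0" if "\<bar>h\<bar> \<le> 1" "x \<notin> S'" for x h
  proof -
    have "x \<notin> S" using that sub by auto
    moreover have "x + h *\<^sub>R e \<notin> S" using mem[of "x + h *\<^sub>R e" h] that by auto
    ultimately show ?thesis by (simp add: dquot_def supp)
  qed
qed

locale test_function =
  fixes u :: "'a::euclidean_space \<Rightarrow> real" and S :: "'a set"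
  assumes u_cont: "continuous_on UNIV u" and S: "compact S" and supp: "\<And>x. x \<notin> S \<Longrightarrow> u x = 0"
begin

text \<open>Differentiability of \<open>f\<close> along \<open>e\<close> is required only almost everywhere; the Lipschitz bound along \<open>e\<close>
  excludes singular contributions. The shift of variables reverses the sign of the step, hence the quotients of
  \<open>f\<close> are taken with steps \<open>-h\<close>.\<close>

lemma integration_by_parts:
  assumes uL: "\<And>x h. \<bar>u (x + h *\<^sub>R e) - u x\<bar> \<le> L * \<bar>h\<bar>"
    and f: "continuous_on UNIV f" and fM: "\<And>x h. \<bar>f (x + h *\<^sub>R e) - f x\<bar> \<le> M * \<bar>h\<bar>"
    and du: "AE x in lborel. (dquot u e x \<longlongrightarrow> u' x) (at 0)"
    and df: "AE x in lborel. (dquot f e x \<longlongrightarrow> f' x) (at 0)"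
  shows "integrable lebesgue (\<lambda>x. u' x * f x)" "integrable lebesgue (\<lambda>x. u x * f' x)"
    and "(\<integral>x. u' x * f x \<partial>lebesgue) = - (\<integral>x. u x * f' x \<partial>lebesgue)"
proof -
  define h where "h = (\<lambda>m. 1 / real (Suc m))"
  have h: "h m \<noteq> 0" "\<bar>h m\<bar> \<le> 1" for m by (auto simp: h_def)
  obtain S' where S': "compact S'" "\<And>x h. \<bar>h\<bar> \<le> 1 \<Longrightarrow> x \<notin> S' \<Longrightarrow> dquot u e x h = 0"
    by (rule dquot_supp[OF S supp]) blast+
  obtain F where F: "\<And>x. x \<in> S' \<Longrightarrow> \<bar>f x\<bar> \<le> F"
    using compact_imp_bounded[OF compact_continuous_image[OF continuous_on_subset[OF f] S'(1)]]
    by (auto simp: bounded_iff)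
  obtain U where U: "\<And>x. x \<in> S \<Longrightarrow> \<bar>u x\<bar> \<le> U"
    using compact_imp_bounded[OF compact_continuous_image[OF continuous_on_subset[OF u_cont] S]]
    by (auto simp: bounded_iff)
  have b1: "\<bar>dquot u e x (h m) * f x\<bar> \<le> (L * F) * indicator S' x" for m x
  proof (cases "x \<in> S'")
    case True
    have "\<bar>dquot u e x (h m)\<bar> \<le> L" by (rule abs_dquot_le[OF uL h(1)])
    then show ?thesis using True F[OF True] by (simp add: abs_mult mult_mono')
  qed (use S'(2) h in auto)
  have b2: "\<bar>u x * dquot f e x (- h m)\<bar> \<le> (U * M) * indicator S x" for m x
  proof (cases "x \<in> S")
    case True
    have "\<bar>dquot f e x (- h m)\<bar> \<le> M" by (rule abs_dquot_le[OF fM]) (use h in auto)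
    then show ?thesis using True U[OF True] by (simp add: abs_mult mult_mono')
  qed (use supp in auto)
  have l1: "AE x in lborel. (\<lambda>m. dquot u e x (h m) * f x) \<longlonglongrightarrow> u' x * f x"
    using du unfolding h_def by eventually_elim (intro tendsto_mult tendsto_const tendsto_steps)
  have l2: "AE x in lborel. (\<lambda>m. u x * dquot f e x (- h m)) \<longlonglongrightarrow> u x * f' x"
    using df unfolding h_def by eventually_elim (intro tendsto_mult tendsto_const tendsto_steps)
  have m1: "(\<lambda>x. dquot u e x (h m) * f x) \<in> borel_measurable borel"
    and m2: "(\<lambda>x. u x * dquot f e x (- h m)) \<in> borel_measurable borel" for m
    using u_cont f by (intro borel_measurable_continuous_onI continuous_on_mult continuous_on_dquot; simp)+
  note L1 = lebesgue_limit[OF m1 l1 S'(1) b1] and L2 = lebesgue_limit[OF m2 l2 S b2]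
  show "integrable lebesgue (\<lambda>x. u' x * f x)" "integrable lebesgue (\<lambda>x. u x * f' x)"
    by (fact L1 L2)+
  have "(\<integral>x. dquot u e x (h m) * f x \<partial>lborel) = - (\<integral>x. u x * dquot f e x (- h m) \<partial>lborel)" for m
  proof -
    have "(\<integral>x. dquot u e x (h m) * f x \<partial>lborel) = (\<integral>x. (u (x + h m *\<^sub>R e) - u x) * f x \<partial>lborel) / h m"
      by (simp add: dquot_def)
    also have "\<dots> = (\<integral>x. u x * (f (x - h m *\<^sub>R e) - f x) \<partial>lborel) / h m"
      by (subst summation_by_parts[OF u_cont S supp f]) auto
    also have "\<dots> = - (\<integral>x. u x * dquot f e x (- h m) \<partial>lborel)"
      by (simp add: dquot_def)
    finally show ?thesis .
  qed
  then have "(\<lambda>m. - (\<integral>x. u x * dquot f e x (- h m) \<partial>lborel)) \<longlonglongrightarrow> (\<integral>x. u' x * f x \<partial>lebesgue)"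
    using L1(2) by simp
  moreover have "(\<lambda>m. - (\<integral>x. u x * dquot f e x (- h m) \<partial>lborel)) \<longlonglongrightarrow> - (\<integral>x. u x * f' x \<partial>lebesgue)"
    using L2(2) by (rule tendsto_minus)
  ultimately show "(\<integral>x. u' x * f x \<partial>lebesgue) = - (\<integral>x. u x * f' x \<partial>lebesgue)"
    by (rule LIMSEQ_unique)
qed

text \<open>Formally both sides equal \<open>-\<integral>u f\<^sub>e\<^sub>d\<close>. No second derivative is available, but the corresponding second
  difference of \<open>f\<close> exists for every step and does not depend on the order of \<open>e\<close> and \<open>d\<close>.\<close>

lemma mixed_derivatives:
  assumes uL: "\<And>x h. \<bar>u (x + h *\<^sub>R e) - u x\<bar> \<le> L * \<bar>h\<bar>" "\<And>x h. \<bar>u (x + h *\<^sub>R d) - u x\<bar> \<le> L' * \<bar>h\<bar>"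
    and f: "continuous_on UNIV f"
    and fM: "\<And>x h. \<bar>f (x + h *\<^sub>R e) - f x\<bar> \<le> M * \<bar>h\<bar>" "\<And>x h. \<bar>f (x + h *\<^sub>R d) - f x\<bar> \<le> M' * \<bar>h\<bar>"
    and du: "AE x in lborel. (dquot u e x \<longlongrightarrow> ue x) (at 0)" "AE x in lborel. (dquot u d x \<longlongrightarrow> ud x) (at 0)"
    and df: "AE x in lborel. (dquot f e x \<longlongrightarrow> fe x) (at 0)" "AE x in lborel. (dquot f d x \<longlongrightarrow> fd x) (at 0)"
  shows "integrable lebesgue (\<lambda>x. ue x * fd x)" "integrable lebesgue (\<lambda>x. ud x * fe x)"
    and "(\<integral>x. ue x * fd x \<partial>lebesgue) = (\<integral>x. ud x * fe x \<partial>lebesgue)"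
proof -
  define h where "h = (\<lambda>m. 1 / real (Suc m))"
  have h: "h m \<noteq> 0" "\<bar>h m\<bar> \<le> 1" for m by (auto simp: h_def)
  obtain S1 where S1: "compact S1" "\<And>x h. \<bar>h\<bar> \<le> 1 \<Longrightarrow> x \<notin> S1 \<Longrightarrow> dquot u e x h = 0"
    by (rule dquot_supp[OF S supp]) blast+
  obtain S2 where S2: "compact S2" "\<And>x h. \<bar>h\<bar> \<le> 1 \<Longrightarrow> x \<notin> S2 \<Longrightarrow> dquot u d x h = 0"
    by (rule dquot_supp[OF S supp]) blast+
  have b1: "\<bar>dquot u e x (h m) * dquot f d x (h m)\<bar> \<le> (L * M') * indicator S1 x" for m x
  proof (cases "x \<in> S1")
    case True
    have "\<bar>dquot u e x (h m)\<bar> \<le> L" by (rule abs_dquot_le[OF uL(1) h(1)])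
    moreover have "\<bar>dquot f d x (h m)\<bar> \<le> M'" by (rule abs_dquot_le[OF fM(2) h(1)])
    ultimately show ?thesis using True by (simp add: abs_mult mult_mono')
  qed (use S1(2) h in auto)
  have b2: "\<bar>dquot u d x (- h m) * dquot f e x (- h m)\<bar> \<le> (L' * M) * indicator S2 x" for m x
  proof (cases "x \<in> S2")
    case True
    have "\<bar>dquot u d x (- h m)\<bar> \<le> L'" by (rule abs_dquot_le[OF uL(2)]) (use h in auto)
    moreover have "\<bar>dquot f e x (- h m)\<bar> \<le> M" by (rule abs_dquot_le[OF fM(1)]) (use h in auto)
    ultimately show ?thesis using True by (simp add: abs_mult mult_mono')
  qed (use S2(2) h in auto)
  have l1: "AE x in lborel. (\<lambda>m. dquot u e x (h m) * dquot f d x (h m)) \<longlonglongrightarrow> ue x * fd x"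
    using du(1) df(2)
    unfolding h_def by eventually_elim (intro tendsto_mult tendsto_steps)
  have l2: "AE x in lborel. (\<lambda>m. dquot u d x (- h m) * dquot f e x (- h m)) \<longlonglongrightarrow> ud x * fe x"
    using du(2) df(1)
    unfolding h_def by eventually_elim (intro tendsto_mult tendsto_steps)
  have m1: "(\<lambda>x. dquot u e x (h m) * dquot f d x (h m)) \<in> borel_measurable borel"
    and m2: "(\<lambda>x. dquot u d x (- h m) * dquot f e x (- h m)) \<in> borel_measurable borel" for m
    using u_cont f by (intro borel_measurable_continuous_onI continuous_on_mult continuous_on_dquot; simp)+
  note L1 = lebesgue_limit[OF m1 l1 S1(1) b1] and L2 = lebesgue_limit[OF m2 l2 S2(1) b2]
  show "integrable lebesgue (\<lambda>x. ue x * fd x)" "integrable lebesgue (\<lambda>x. ud x * fe x)"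
    by (fact L1 L2)+
  have "(\<integral>x. dquot u e x (h m) * dquot f d x (h m) \<partial>lborel)
      = (\<integral>x. dquot u d x (- h m) * dquot f e x (- h m) \<partial>lborel)" for m
  proof -
    define a where "a = h m *\<^sub>R e"
    define b where "b = h m *\<^sub>R d"
    have cd: "continuous_on UNIV (\<lambda>x. f (x + b) - f x)" "continuous_on UNIV (\<lambda>x. f (x - a) - f x)"
      using continuous_on_translate[OF f, of b] continuous_on_translate[OF f, of "- a"] f
      by (auto intro!: continuous_intros)
    have "(\<integral>x. dquot u e x (h m) * dquot f d x (h m) \<partial>lborel)
        = (\<integral>x. (u (x + a) - u x) * (f (x + b) - f x) \<partial>lborel) / (h m * h m)"
      by (simp add: dquot_def a_def b_def)
    also have "(\<integral>x. (u (x + a) - u x) * (f (x + b) - f x) \<partial>lborel)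
        = (\<integral>x. u x * ((f (x - a + b) - f (x - a)) - (f (x + b) - f x)) \<partial>lborel)"
      by (rule summation_by_parts[OF u_cont S supp cd(1)])
    also have "\<dots> = (\<integral>x. u x * ((f (x - (- b) - a) - f (x - (- b))) - (f (x - a) - f x)) \<partial>lborel)"
      by (intro Bochner_Integration.integral_cong refl) (simp add: algebra_simps)
    also have "\<dots> = (\<integral>x. (u (x + (- b)) - u x) * (f (x - a) - f x) \<partial>lborel)"
      by (rule summation_by_parts[OF u_cont S supp cd(2), symmetric])
    also have "\<dots> / (h m * h m) = (\<integral>x. dquot u d x (- h m) * dquot f e x (- h m) \<partial>lborel)"
      by (simp add: dquot_def a_def b_def)
    finally show ?thesis .
  qed
  then have "(\<lambda>m. (\<integral>x. dquot u d x (- h m) * dquot f e x (- h m) \<partial>lborel)) \<longlonglongrightarrow> (\<integral>x. ue x * fd x \<partial>lebesgue)"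
    using L1(2) by simp
  then show "(\<integral>x. ue x * fd x \<partial>lebesgue) = (\<integral>x. ud x * fe x \<partial>lebesgue)"
    using L2(2) LIMSEQ_unique by blast
qed

end

lemma has_derivative_dquot:
  assumes "(f has_derivative f') (at x)"
  shows "(dquot f e x \<longlongrightarrow> f' e) (at 0)"
proof -
  have "((\<lambda>h. x + h *\<^sub>R e) has_derivative (\<lambda>h. h *\<^sub>R e)) (at 0)"
    by (auto intro!: derivative_eq_intros)
  then have "((\<lambda>h. f (x + h *\<^sub>R e)) has_derivative (\<lambda>h. f' (h *\<^sub>R e))) (at 0)"
    using has_derivative_compose[of "\<lambda>h. x + h *\<^sub>R e" "\<lambda>h. h *\<^sub>R e" 0 UNIV f f'] assms by simp
  moreover have "(\<lambda>h. f' (h *\<^sub>R e)) = (*) (f' e)"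
    using linear_cmul[OF has_derivative_linear[OF assms]] by (auto simp: fun_eq_iff mult.commute)
  ultimately have "((\<lambda>h. f (x + h *\<^sub>R e)) has_real_derivative f' e) (at 0)"
    by (simp add: has_field_derivative_def)
  then show ?thesis by (simp add: DERIV_def dquot_def[abs_def])
qed

text \<open>An isolated singularity does no harm: the mean value theorem applies on every line that avoids the
  origin, and the line through the origin is a limit of such lines.\<close>

lemma bounded_dquot_lipschitz:
  fixes f :: "real \<times> real \<Rightarrow> real"
  assumes f: "continuous_on UNIV f" and e: "e = (1, 0) \<or> e = (0, 1)"
    and lim: "\<And>p. p \<noteq> 0 \<Longrightarrow> (dquot f e p \<longlongrightarrow> f' p) (at 0)"
    and M: "\<And>p. p \<noteq> 0 \<Longrightarrow> \<bar>f' p\<bar> \<le> M"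
  shows "\<bar>f (p + h *\<^sub>R e) - f p\<bar> \<le> M * \<bar>h\<bar>"
proof -
  have off: "\<bar>f (p + h *\<^sub>R e) - f p\<bar> \<le> M * \<bar>h\<bar>" if avoid: "\<And>t. p + t *\<^sub>R e \<noteq> 0" for p
  proof -
    have "((\<lambda>t. f (p + t *\<^sub>R e)) has_real_derivative f' (p + t *\<^sub>R e)) (at t)" for t
      using lim[OF avoid[of t]] by (simp add: DERIV_def dquot_def[abs_def] algebra_simps)
    then have "norm (f (p + h *\<^sub>R e) - f (p + 0 *\<^sub>R e)) \<le> M * norm (h - 0)"
      by (intro field_differentiable_bound[of UNIV "\<lambda>t. f (p + t *\<^sub>R e)" "\<lambda>t. f' (p + t *\<^sub>R e)"])
         (use M[OF avoid] in auto)
    then show ?thesis by simp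
  qed
  \<comment> \<open>The other axis, along which the line is moved off the origin.\<close>
  define d where "d = (snd e, fst e)"
  show ?thesis
  proof (cases "\<forall>t. p + t *\<^sub>R e \<noteq> 0")
    case False
    then obtain t where t: "p = - (t *\<^sub>R e)" by (auto simp: add_eq_0_iff2)
    have "p + s *\<^sub>R d + a *\<^sub>R e \<noteq> 0" if "s \<noteq> 0" for s a
      using e that by (auto simp: t d_def prod_eq_iff)
    then have "eventually (\<lambda>s. \<bar>f (p + s *\<^sub>R d + h *\<^sub>R e) - f (p + s *\<^sub>R d)\<bar> \<le> M * \<bar>h\<bar>) (at 0)"
      using off by (auto simp: eventually_at intro!: exI[of _ 1])
    moreover have "((\<lambda>s. f (p + s *\<^sub>R d + c)) \<longlongrightarrow> f (p + 0 *\<^sub>R d + c)) (at 0)" for c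
    proof -
      have "continuous_on UNIV (\<lambda>s. f (p + s *\<^sub>R d + c))"
        by (rule continuous_on_compose2[OF f]) (auto intro!: continuous_intros)
      then show ?thesis by (metis UNIV_I continuous_on_def)
    qed
    from this[of "h *\<^sub>R e"] this[of 0]
    have "((\<lambda>s. \<bar>f (p + s *\<^sub>R d + h *\<^sub>R e) - f (p + s *\<^sub>R d)\<bar>) \<longlongrightarrow> \<bar>f (p + h *\<^sub>R e) - f p\<bar>) (at 0)"
      by (intro tendsto_rabs tendsto_diff) auto
    ultimately show ?thesis by (intro tendsto_upperbound) auto
  qed (use off in auto)
qed

section \<open>Calculus of smooth functions\<close>

lemma Ck_on_SucI:
  assumes "\<And>x. (f has_derivative f' x) (at x)" "\<And>v. Ck_on n UNIV (\<lambda>x. f' x v)"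
  shows "Ck_on (Suc n) UNIV f"
proof -
  have "frechet_derivative f (at x) = f' x" for x
    using assms(1) frechet_derivative_at by metis
  then show ?thesis using assms by (auto simp: differentiable_def)
qed

lemma Ck_on_Suc_has_derivative:
  assumes "Ck_on (Suc n) UNIV f"
  shows "(f has_derivative frechet_derivative f (at x)) (at x)"
  using assms by (simp flip: frechet_derivative_works)

lemma Ck_on_SucD:
  assumes "Ck_on (Suc n) UNIV f" shows "Ck_on n UNIV f"
  using assms
proof (induction n arbitrary: f)
  case 0
  then show ?case
    by (auto intro!: differentiable_imp_continuous_on simp: differentiable_on_def intro: differentiable_at_withinI)
next
  case (Suc n)
  then show ?case by (metis Ck_on.simps(2))
qed

lemma Ck_on_const: "Ck_on n UNIV (\<lambda>x. c)"
  by (induction n arbitrary: c) (auto intro!: Ck_on_SucI derivative_intros simp del: Ck_on.simps(2))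

lemma Ck_on_bounded_linear:
  assumes "bounded_linear f" shows "Ck_on n UNIV f"
proof (cases n)
  case 0
  then show ?thesis using assms by (simp add: linear_continuous_on)
next
  case (Suc m)
  then show ?thesis
    unfolding Suc
    by (intro Ck_on_SucI[where f' = "\<lambda>x. f"] bounded_linear_imp_has_derivative assms Ck_on_const)
qed

lemma Ck_on_add:
  "Ck_on n UNIV f \<Longrightarrow> Ck_on n UNIV g \<Longrightarrow> Ck_on n UNIV (\<lambda>x. f x + g x)"
proof (induction n arbitrary: f g)
  case (Suc n)
  show ?case
    by (rule Ck_on_SucI[OF has_derivative_add[OF Suc.prems[THEN Ck_on_Suc_has_derivative]]])
       (use Suc in auto)
qed (auto intro: continuous_intros)

lemma Ck_on_mult:
  fixes f g :: "'a::real_normed_vector \<Rightarrow> real"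
  shows "Ck_on n UNIV f \<Longrightarrow> Ck_on n UNIV g \<Longrightarrow> Ck_on n UNIV (\<lambda>x. f x * g x)"
proof (induction n arbitrary: f g)
  case (Suc n)
  show ?case
  proof (rule Ck_on_SucI[OF has_derivative_mult[OF Suc.prems[THEN Ck_on_Suc_has_derivative]]])
    show "Ck_on n UNIV (\<lambda>x. f x * frechet_derivative g (at x) v + frechet_derivative f (at x) v * g x)" for v
      using Suc.prems Suc.prems[THEN Ck_on_SucD] by (intro Ck_on_add Suc.IH) auto
  qed
qed (auto intro: continuous_intros)

lemma Ck_on_inverse:
  fixes f :: "'a::real_normed_vector \<Rightarrow> real"
  assumes nz: "\<And>x. f x \<noteq> 0"
  shows "Ck_on n UNIV f \<Longrightarrow> Ck_on n UNIV (\<lambda>x. inverse (f x))"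
proof (induction n)
  case (Suc n)
  have inv: "Ck_on n UNIV (\<lambda>x. inverse (f x))" using Suc Ck_on_SucD by blast
  show ?case
  proof (rule Ck_on_SucI[OF Deriv.has_derivative_inverse[OF nz Ck_on_Suc_has_derivative[OF Suc.prems]]])
    have "Ck_on n UNIV (\<lambda>x. - 1 * (inverse (f x) * frechet_derivative f (at x) v * inverse (f x)))" for v
      using Suc.prems by (intro Ck_on_mult inv Ck_on_const) auto
    then show "Ck_on n UNIV (\<lambda>x. - (inverse (f x) * frechet_derivative f (at x) v * inverse (f x)))" for v
      by simp
  qed
qed (auto intro: continuous_intros simp: nz)

lemma Ck_on_power:
  fixes f :: "'a::real_normed_vector \<Rightarrow> real"
  assumes "Ck_on n UNIV f" shows "Ck_on n UNIV (\<lambda>x. f x ^ m)"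
  by (induction m) (auto intro: Ck_on_mult Ck_on_const assms)

section \<open>The coefficient\<close>

text \<open>Near the origin this is \<open>x\<^sup>2 + z\<^sup>2\<close> to leading order, so its powers vanish to any prescribed order
  there. Since it saturates at \<open>1\<close>, they are bounded with bounded derivatives on the whole plane, which is
  what an estimate uniform in \<open>z\<close> calls for.\<close>

definition sat :: "real \<Rightarrow> real \<Rightarrow> real" where
  "sat x z = (x\<^sup>2 + z\<^sup>2) / (1 + x\<^sup>2 + z\<^sup>2)"

text \<open>The Hessian determinant \<open>\<Phi>\<^sub>x\<^sub>x \<Phi>\<^sub>z\<^sub>z - \<Phi>\<^sub>x\<^sub>z\<^sup>2\<close>. For \<open>\<Phi> = F(s)/2\<close> it equals \<open>F' (F' + 2 s F'')\<close>, and
  \<open>F' = t\<^sup>n\<close> gives \<open>s F'' = n t\<^sup>n (1 - t)\<close>.\<close>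

definition coeff :: "nat \<Rightarrow> real \<Rightarrow> real \<Rightarrow> real \<Rightarrow> real" where
  "coeff n x y z = sat x z ^ (2 * n) * (1 + 2 * n * (1 - sat x z))"

text \<open>This is \<open>\<Phi>\<^sub>z\<close>. Replacing \<open>(x, y)\<close> by the variables \<open>(x, z)\<close> with \<open>y = \<Phi>\<^sub>z(x, z)\<close> makes the equation
  explicit.\<close>

definition hodograph :: "nat \<Rightarrow> real \<Rightarrow> real \<Rightarrow> real" where
  "hodograph n x z = z * sat x z ^ n"

lemma one_plus_pos: "1 + x\<^sup>2 + z\<^sup>2 > (0::real)" "1 + x\<^sup>2 + z\<^sup>2 \<noteq> (0::real)"
proof -
  show "1 + x\<^sup>2 + z\<^sup>2 > (0::real)" using zero_le_power2[of x] zero_le_power2[of z] by linarith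
  then show "1 + x\<^sup>2 + z\<^sup>2 \<noteq> (0::real)" by linarith
qed

lemma sat_nonneg: "0 \<le> sat x z" and sat_less_1: "sat x z < 1"
  using one_plus_pos[of x z] by (auto simp: sat_def divide_simps)

lemma sat_0: "sat 0 0 = 0" by (simp add: sat_def)

lemma sat_pos: "\<not> (x = 0 \<and> z = 0) \<Longrightarrow> 0 < sat x z"
  using one_plus_pos[of x z] by (auto simp: sat_def sum_power2_gt_zero_iff)

lemma smooth_coeff: "smooth_on UNIV (\<lambda>(x, y, z). coeff n x y z)"
proof -
  have s: "Ck_on m UNIV (\<lambda>p::real\<times>real\<times>real. (fst p)\<^sup>2 + (snd (snd p))\<^sup>2)" for m
    by (intro Ck_on_add Ck_on_power Ck_on_bounded_linear bounded_linear_fst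
        bounded_linear_compose[OF bounded_linear_snd bounded_linear_snd, unfolded o_def] )
  have sat_Ck: "Ck_on m UNIV (\<lambda>p::real\<times>real\<times>real. sat (fst p) (snd (snd p)))" for m
  proof -
    have "Ck_on m UNIV (\<lambda>p::real\<times>real\<times>real. ((fst p)\<^sup>2 + (snd (snd p))\<^sup>2) *
        inverse (1 + ((fst p)\<^sup>2 + (snd (snd p))\<^sup>2)))"
      using one_plus_pos(2) by (intro Ck_on_mult s Ck_on_inverse Ck_on_add[OF Ck_on_const s]) (simp add: add.assoc)
    then show ?thesis by (simp add: sat_def divide_inverse add.assoc)
  qed
  have "Ck_on m UNIV (\<lambda>p::real\<times>real\<times>real.
      sat (fst p) (snd (snd p)) ^ (2 * n) * (1 + 2 * n * (1 + (-1) * sat (fst p) (snd (snd p)))))" for m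
    by (intro Ck_on_mult Ck_on_add Ck_on_power sat_Ck Ck_on_const)
  then show ?thesis by (simp add: smooth_on_def coeff_def case_prod_unfold)
qed

lemma coeff_ge: "sat x z ^ (2 * n) \<le> coeff n x y z"
  using sat_less_1[of x z] sat_nonneg[of x z] by (simp add: coeff_def mult_le_cancel_left1)

lemma coeff_le: "coeff n x y z \<le> (1 + 2 * real n) * sat x z ^ (2 * n)"
proof -
  have "1 + 2 * real n * (1 - sat x z) \<le> 1 + 2 * n"
    using sat_nonneg[of x z] mult_left_le[of "1 - sat x z" "2 * real n"] by simp
  from mult_right_mono[OF this, of "sat x z ^ (2 * n)"] sat_nonneg[of x z] show ?thesis
    by (simp add: coeff_def mult.commute)
qed

lemma coeff_nonneg: "0 \<le> coeff n x y z"
  using coeff_ge[of x z n y] sat_nonneg[of x z] by (meson order_trans zero_le_power)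

lemma coeff_pos: "\<not> (x = 0 \<and> z = 0) \<Longrightarrow> 0 < coeff n x y z"
  using coeff_ge[of x z n y] sat_pos[of x z] by (metis order_less_le_trans zero_less_power)

lemma sat_has_derivative_z: "((\<lambda>z. sat x z) has_real_derivative 2 * z / (1 + x\<^sup>2 + z\<^sup>2)\<^sup>2) (at z)"
  unfolding sat_def using one_plus_pos[of x z]
  by (auto intro!: derivative_eq_intros simp: field_simps power2_eq_square)

text \<open>The derivative of \<open>t\<close> in \<open>z\<close> is at most \<open>2 \<surd>t\<close> in absolute value, so differentiating costs half a power of \<open>t\<close>.\<close>

lemma coeff_deriv_bound:
  assumes n: "n \<ge> 1"
  shows "\<bar>deriv (\<lambda>s. coeff n x y s) z\<bar> \<le> 8 * n * (n + 1) * (sat x z ^ (2 * n - 1) * sqrt (sat x z))"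
proof -
  define t where "t = sat x z"
  define d where "d = 2 * z / (1 + x\<^sup>2 + z\<^sup>2)\<^sup>2"
  have t: "0 \<le> t" "t < 1" using sat_nonneg sat_less_1 by (auto simp: t_def)
  have "((\<lambda>s. coeff n x y s) has_real_derivative
      (real (2 * n) * t ^ (2 * n - 1) * d) * (1 + 2 * n * (1 - t)) + t ^ (2 * n) * (2 * n * (- d))) (at z)"
    unfolding coeff_def t_def
    by (auto intro!: derivative_eq_intros sat_has_derivative_z[of x z, folded d_def] simp: algebra_simps)
  then have "deriv (\<lambda>s. coeff n x y s) z =
      (real (2 * n) * t ^ (2 * n - 1) * d) * (1 + 2 * n * (1 - t)) + t ^ (2 * n) * (2 * n * (- d))"
    by (rule DERIV_imp_deriv)
  also have "t ^ (2 * n) = t ^ (2 * n - 1) * t"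
    using n by (metis mult_2 add_leD1 le_add1 one_le_numeral power_minus_mult order_less_le_trans trans_le_add1 zero_less_one)
  finally have eq: "deriv (\<lambda>s. coeff n x y s) z = 2 * n * (t ^ (2 * n - 1) * (d * (1 + 2 * n * (1 - t) - t)))"
    by (simp add: algebra_simps)
  have d: "\<bar>d\<bar> \<le> 2 * sqrt t"
  proof -
    define b where "b = 1 + x\<^sup>2 + z\<^sup>2"
    have b: "b \<ge> 1" by (simp add: b_def)
    have "\<bar>z\<bar> / b\<^sup>2 \<le> \<bar>z\<bar> / b"
      using b by (intro divide_left_mono) (auto simp: power2_eq_square)
    also have "\<dots> \<le> \<bar>z\<bar> / sqrt b"
      using b sqrt_le_D by (intro divide_left_mono) (auto intro!: real_le_lsqrt simp: power2_eq_square)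
    also have "\<dots> \<le> sqrt (x\<^sup>2 + z\<^sup>2) / sqrt b"
      using b by (intro divide_right_mono) auto
    also have "\<dots> = sqrt t" by (simp add: t_def sat_def b_def real_sqrt_divide)
    finally show ?thesis by (simp add: d_def b_def abs_mult)
  qed
  define v where "v = real n * (1 - t)"
  have "0 \<le> v" "v \<le> real n"
    using t by (auto simp: v_def intro: mult_left_le)
  moreover have "1 + 2 * n * (1 - t) - t = 1 + 2 * v - t" by (simp add: v_def)
  ultimately have c: "\<bar>1 + 2 * n * (1 - t) - t\<bar> \<le> 2 * n + 2"
    using t by (simp add: abs_le_iff)
  have "\<bar>d * (1 + 2 * n * (1 - t) - t)\<bar> \<le> (2 * sqrt t) * (2 * n + 2)"
    unfolding abs_mult using d c t by (intro mult_mono) auto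
  then have "t ^ (2 * n - 1) * \<bar>d * (1 + 2 * n * (1 - t) - t)\<bar> \<le> t ^ (2 * n - 1) * ((2 * sqrt t) * (2 * n + 2))"
    using t by (intro mult_left_mono) auto
  then have "2 * real n * (t ^ (2 * n - 1) * \<bar>d * (1 + 2 * n * (1 - t) - t)\<bar>) \<le> 2 * real n * (t ^ (2 * n - 1) * ((2 * sqrt t) * (2 * n + 2)))"
    by (rule mult_left_mono) simp
  also have "2 * real n * (t ^ (2 * n - 1) * ((2 * sqrt t) * (2 * n + 2))) = 8 * real n * (real n + 1) * (t ^ (2 * n - 1) * sqrt t)"
    by (simp add: algebra_simps)
  finally show ?thesis unfolding eq t_def[symmetric] using t by (simp add: abs_mult)
qed

text \<open>Since \<open>k\<close> is comparable to \<open>t\<^bsup>2n\<^esup>\<close>, the factor \<open>k\<^bsup>-\<epsilon>\<^esup>\<close> is at least a multiple of \<open>t\<^bsup>-2n\<epsilon>\<^esup>\<close>, which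
  dominates the lost \<open>t\<^bsup>-1/2\<^esup>\<close> as soon as \<open>2n\<epsilon> \<ge> 1/2\<close>. Splitting off \<open>k\<^bsup>-\<epsilon>\<^esup>\<close> covers \<open>\<epsilon> < 1\<close> and \<open>\<epsilon> \<ge> 1\<close> alike.\<close>

lemma coeff_deriv_powr:
  assumes n: "n \<ge> 1" and \<epsilon>: "4 * n * \<epsilon> \<ge> 1"
  shows "\<bar>deriv (\<lambda>s. coeff n x y s) z\<bar> \<le> 8 * n * (n + 1) * (1 + 2 * real n) powr \<epsilon> * coeff n x y z powr (1 - \<epsilon>)"
proof (cases "x = 0 \<and> z = 0")
  case True
  then show ?thesis using coeff_deriv_bound[OF n, of x y z] n by (simp add: sat_0)
next
  case False
  define t where "t = sat x z"
  have t: "0 < t" "t < 1" using False sat_pos sat_less_1 by (auto simp: t_def)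
  define K where "K = coeff n x y z"
  have K: "K > 0" "K \<ge> t ^ (2 * n)" "K \<le> (1 + 2 * real n) * t ^ (2 * n)"
    unfolding K_def t_def using coeff_pos[OF False] coeff_ge coeff_le by auto
  have \<epsilon>0: "\<epsilon> > 0" using \<epsilon> n by (smt (verit) mult_nonneg_nonpos of_nat_0_le_iff)
  have "K powr \<epsilon> \<le> ((1 + 2 * real n) * t ^ (2 * n)) powr \<epsilon>"
    using K \<epsilon>0 by (intro powr_mono2) auto
  also have "\<dots> = (1 + 2 * real n) powr \<epsilon> * t powr (2 * n * \<epsilon>)"
    using t by (simp add: powr_mult powr_powr flip: powr_realpow)
  also have "\<dots> \<le> (1 + 2 * real n) powr \<epsilon> * t powr (1 / 2)"
    using t \<epsilon> by (intro mult_left_mono powr_mono') auto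
  also have "t powr (1 / 2) = sqrt t" using t by (simp add: powr_half_sqrt)
  finally have Ke: "K powr \<epsilon> \<le> (1 + 2 * real n) powr \<epsilon> * sqrt t" .
  have tt: "t ^ (2 * n) = t ^ (2 * n - 1) * t"
    using n by (metis mult_2 add_leD1 le_add1 one_le_numeral power_minus_mult order_less_le_trans trans_le_add1 zero_less_one)
  have "t ^ (2 * n - 1) * sqrt t * K powr \<epsilon> \<le> t ^ (2 * n - 1) * sqrt t * ((1 + 2 * real n) powr \<epsilon> * sqrt t)"
    using Ke t by (intro mult_left_mono) auto
  also have "\<dots> = (1 + 2 * real n) powr \<epsilon> * t ^ (2 * n)"
    using t by (simp add: tt)
  also have "\<dots> \<le> (1 + 2 * real n) powr \<epsilon> * K"
    using K by (intro mult_left_mono) auto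
  finally have "t ^ (2 * n - 1) * sqrt t \<le> (1 + 2 * real n) powr \<epsilon> * (K / K powr \<epsilon>)"
    using K by (simp add: field_simps)
  also have "K / K powr \<epsilon> = K powr (1 - \<epsilon>)" using K by (simp add: powr_diff)
  finally have "t ^ (2 * n - 1) * sqrt t \<le> (1 + 2 * real n) powr \<epsilon> * K powr (1 - \<epsilon>)" .
  then have "8 * real n * (real n + 1) * (t ^ (2 * n - 1) * sqrt t) \<le> 8 * real n * (real n + 1) * ((1 + 2 * real n) powr \<epsilon> * K powr (1 - \<epsilon>))"
    by (rule mult_left_mono) simp
  from order_trans[OF coeff_deriv_bound[OF n, of x y z, folded t_def] this]
  show ?thesis unfolding K_def by (simp add: mult.assoc)
qed

section \<open>The solution and its stream function\<close>

definition sol :: "nat \<Rightarrow> real \<times> real \<Rightarrow> real" where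
  "sol n = (\<lambda>(x, y). THE z. hodograph n x z = y)"

lemma hodograph_minus: "hodograph n x (- z) = - hodograph n x z"
  by (simp add: hodograph_def sat_def)

lemma sat_mono: "0 \<le> z \<Longrightarrow> z \<le> z' \<Longrightarrow> sat x z \<le> sat x z'"
proof -
  assume "0 \<le> z" "z \<le> z'"
  then have "z\<^sup>2 \<le> z'\<^sup>2" by (rule power_mono[rotated])
  then show ?thesis using one_plus_pos[of x z] one_plus_pos[of x z']
    by (simp add: sat_def divide_simps) (simp add: algebra_simps)
qed

lemma hodograph_less: assumes "z < z'" shows "hodograph n x z < hodograph n x z'"
proof -
  have pos: "hodograph n x a < hodograph n x b" if "0 \<le> a" "a < b" for a b
  proof -
    have "a * sat x a ^ n \<le> a * sat x b ^ n"
      using that sat_mono[of a b x] sat_nonneg[of x a] by (intro mult_left_mono power_mono) auto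
    also have "\<dots> < b * sat x b ^ n"
      using that sat_pos[of x b] by (intro mult_strict_right_mono) auto
    finally show ?thesis by (simp add: hodograph_def)
  qed
  have hodograph_0: "hodograph n x 0 = 0" by (simp add: hodograph_def)
  consider "0 \<le> z" | "z' \<le> 0" | "z < 0" "0 < z'" using assms by linarith
  then show ?thesis
  proof cases
    case 2
    then show ?thesis using pos[of "- z'" "- z"] assms by (simp add: hodograph_minus)
  next
    case 3
    then show ?thesis using pos[of 0 "- z"] pos[of 0 z'] by (simp add: hodograph_minus hodograph_0)
  qed (use pos assms in auto)
qed

lemma hodograph_less_iff: "hodograph n x z < hodograph n x z' \<longleftrightarrow> z < z'"
  using hodograph_less[of z z' n x] hodograph_less[of z' z n x] by (cases z z' rule: linorder_cases) auto

lemma continuous_on_sat [continuous_intros]: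
  assumes "continuous_on S f" "continuous_on S g"
  shows "continuous_on S (\<lambda>x. sat (f x) (g x))"
  unfolding sat_def using assms one_plus_pos(2) by (intro continuous_intros) auto

lemma continuous_on_hodograph [continuous_intros]:
  assumes "continuous_on S f" "continuous_on S g"
  shows "continuous_on S (\<lambda>x. hodograph n (f x) (g x))"
  unfolding hodograph_def using assms by (intro continuous_intros)

lemma hodograph_surj: "\<exists>z. hodograph n x z = y"
proof -
  have ge: "\<exists>z. hodograph n x z = y" if "0 \<le> y" for y
  proof -
    \<comment> \<open>For \<open>z \<ge> 1\<close> one has \<open>t \<ge> 1/2\<close>, so this \<open>z\<close> makes \<open>z t\<^sup>n\<close> at least \<open>y\<close>.\<close>
    define z where "z = 1 + 2 ^ n * y"
    have z: "1 \<le> z" using that by (simp add: z_def)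
    then have "1 \<le> z\<^sup>2" by simp
    then have "1 / 2 \<le> sat x z" using zero_le_power2[of x]
      unfolding sat_def pos_le_divide_eq[OF one_plus_pos(1)] by (simp add: field_simps add_increasing)
    then have "(1 / 2) ^ n \<le> sat x z ^ n" by (rule power_mono) auto
    then have "z * (1 / 2) ^ n \<le> hodograph n x z" using z by (simp add: hodograph_def mult_left_mono)
    moreover have "y \<le> z * (1 / 2) ^ n" using that by (simp add: z_def power_divide divide_simps)
    ultimately have "y \<le> hodograph n x z" by linarith
    moreover have "hodograph n x 0 \<le> y" using that by (simp add: hodograph_def)
    moreover have "continuous_on {0..z} (hodograph n x)" by (intro continuous_intros)
    ultimately show ?thesis using IVT'[of "hodograph n x" 0 y z] z by auto
  qed
  show ?thesis
  proof (cases "0 \<le> y")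
    case False
    then obtain z where "hodograph n x z = - y" using ge[of "- y"] by auto
    then have "hodograph n x (- z) = y" by (simp add: hodograph_minus)
    then show ?thesis by blast
  qed (use ge in auto)
qed

lemma sol_hodograph [simp]: "sol n (x, hodograph n x z) = z"
  unfolding sol_def using hodograph_less by (auto intro!: the_equality) (metis linorder_neq_iff)

lemma hodograph_sol [simp]: "hodograph n x (sol n (x, y)) = y"
  using hodograph_surj[of n x y] sol_hodograph by metis

lemma sol_less_iff: "sol n (x, y) < c \<longleftrightarrow> y < hodograph n x c"
  using hodograph_less_iff[of n x "sol n (x, y)" c] by simp

lemma less_sol_iff: "c < sol n (x, y) \<longleftrightarrow> hodograph n x c < y"
  using hodograph_less_iff[of n x c "sol n (x, y)"] by simp

text \<open>Monotonicity of \<open>\<Phi>\<^sub>z\<close> in \<open>z\<close> turns the sublevel and superlevel sets of the solution into sets defined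
  by strict inequalities between continuous functions.\<close>

lemma continuous_sol: "continuous_on UNIV (sol n)"
proof (rule continuous_at_imp_continuous_on, intro ballI)
  fix p
  have o: "open {p. c < sol n p}" "open {p. sol n p < c}" for c
  proof -
    have "{p. c < sol n p} = {p. hodograph n (fst p) c < snd p}" "{p. sol n p < c} = {p. snd p < hodograph n (fst p) c}"
      using sol_less_iff less_sol_iff by auto
    then show "open {p. c < sol n p}" "open {p. sol n p < c}"
      by (auto intro!: open_Collect_less continuous_intros)
  qed
  show "isCont (sol n) p"
    unfolding isCont_def
  proof (rule order_tendstoI)
    show "eventually (\<lambda>q. a < sol n q) (at p)" if "a < sol n p" for a
      using o(1)[of a] that unfolding eventually_at_topological by blast
    show "eventually (\<lambda>q. sol n q < a) (at p)" if "sol n p < a" for a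
      using o(2)[of a] that unfolding eventually_at_topological by blast
  qed
qed

lemma sol_axis: "sol n (x, 0) = 0"
  using sol_hodograph[of n x 0] by (simp add: hodograph_def)

lemma sol_eq_0_iff: "sol n (x, y) = 0 \<longleftrightarrow> y = 0"
  using hodograph_sol[of n x y] sol_axis by (metis hodograph_def mult_zero_left)

text \<open>The formulas for \<open>w\<^sub>x = -\<Phi>\<^sub>x\<^sub>z/\<Phi>\<^sub>z\<^sub>z\<close> and \<open>w\<^sub>y = 1/\<Phi>\<^sub>z\<^sub>z\<close> in the variables \<open>(x, z)\<close>, where
  \<open>\<Phi>\<^sub>z\<^sub>z = t\<^sup>n (1 + 2 n z\<^sup>2 / (s (1 + s)))\<close> and \<open>\<Phi>\<^sub>x\<^sub>z = 2 n x z t\<^sup>n / (s (1 + s))\<close>. At the origin both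
  quotients have denominator \<open>0\<close> and so the value \<open>0\<close>, which keeps the bounds below valid everywhere.\<close>

definition slope_num :: "real \<Rightarrow> real \<Rightarrow> real" where
  "slope_num x z = (x\<^sup>2 + z\<^sup>2) * (1 + x\<^sup>2 + z\<^sup>2)"

definition slope_den :: "nat \<Rightarrow> real \<Rightarrow> real \<Rightarrow> real" where
  "slope_den n x z = slope_num x z + 2 * n * z\<^sup>2"

definition sol_slope_x :: "nat \<Rightarrow> real \<Rightarrow> real \<Rightarrow> real" where
  "sol_slope_x n x z = - (2 * n * x * z) / slope_den n x z"

definition sol_slope_y :: "nat \<Rightarrow> real \<Rightarrow> real \<Rightarrow> real" where
  "sol_slope_y n x z = slope_num x z / (sat x z ^ n * slope_den n x z)"

lemma slope_num_pos: "\<not> (x = 0 \<and> z = 0) \<Longrightarrow> 0 < slope_num x z"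
  unfolding slope_num_def using one_plus_pos[of x z] by (simp add: sum_power2_gt_zero_iff)

lemma slope_den_ge: "slope_num x z \<le> slope_den n x z" by (simp add: slope_den_def)
lemma slope_den_pos: "\<not> (x = 0 \<and> z = 0) \<Longrightarrow> 0 < slope_den n x z" using slope_num_pos slope_den_ge by (meson order_less_le_trans)

lemma sat_power_has_derivative:
  assumes nz: "\<not> (x = 0 \<and> z = 0)"
  shows "((\<lambda>p. sat (fst p) (snd p) ^ n) has_derivative
    (\<lambda>p. 2 * n * sat x z ^ n / slope_num x z * (x * fst p + z * snd p))) (at (x, z))"
proof -
  define s where "s = x\<^sup>2 + z\<^sup>2"
  have s: "s > 0" using nz by (simp add: s_def sum_power2_gt_zero_iff)
  have "((\<lambda>p. sat (fst p) (snd p)) has_derivative (\<lambda>p. 2 * (x * fst p + z * snd p) / (1 + s)\<^sup>2)) (at (x, z))"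
    unfolding sat_def using s one_plus_pos[of x z]
    by (auto intro!: derivative_eq_intros simp: fun_eq_iff s_def field_simps power2_eq_square)
  from has_derivative_power[OF this, of n]
  have "((\<lambda>p. sat (fst p) (snd p) ^ n) has_derivative
      (\<lambda>p. n * (2 * (x * fst p + z * snd p) / (1 + s)\<^sup>2) * sat x z ^ (n - 1))) (at (x, z))"
    by (simp add: mult_ac)
  moreover have "n * (2 * (x * a + z * b) / (1 + s)\<^sup>2) * sat x z ^ (n - 1)
      = 2 * n * sat x z ^ n / slope_num x z * (x * a + z * b)" for a b
  proof (cases n)
    case (Suc m)
    have "sat x z = s / (1 + s)" "slope_num x z = s * (1 + s)" by (simp_all add: sat_def slope_num_def s_def add.assoc)
    moreover have "n * (2 * X / (1 + s)\<^sup>2) * \<tau> = 2 * n * (s / (1 + s) * \<tau>) / (s * (1 + s)) * X" for X \<tau>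
      using s by (simp add: power2_eq_square)
    ultimately show ?thesis unfolding Suc by (metis diff_Suc_1 power_Suc)
  qed simp
  ultimately show ?thesis by simp
qed

text \<open>The map \<open>(x, z) \<mapsto> (x, \<Phi>\<^sub>z(x, z))\<close> has the continuous inverse \<open>(x, y) \<mapsto> (x, w(x, y))\<close> and an
  invertible derivative off the origin.\<close>

lemma sol_has_derivative:
  assumes "(x, y) \<noteq> 0"
  shows "(sol n has_derivative (\<lambda>p. sol_slope_x n x (sol n (x, y)) * fst p + sol_slope_y n x (sol n (x, y)) * snd p)) (at (x, y))"
proof -
  define z where "z = sol n (x, y)"
  have y: "y = hodograph n x z" by (simp add: z_def)
  have nz: "\<not> (x = 0 \<and> z = 0)" using assms sol_eq_0_iff[of n x y] by (auto simp: z_def zero_prod_def)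
  note pos = slope_num_pos[OF nz] slope_den_pos[OF nz, of n] zero_less_power[OF sat_pos[OF nz], of n]
  define hx where "hx = 2 * n * sat x z ^ n / slope_num x z * x * z"
  define hz where "hz = sat x z ^ n * slope_den n x z / slope_num x z"
  have dH: "((\<lambda>p. hodograph n (fst p) (snd p)) has_derivative (\<lambda>p. hx * fst p + hz * snd p)) (at (x, z))"
    unfolding hodograph_def
    by (rule has_derivative_eq_rhs[OF has_derivative_mult[OF has_derivative_snd[OF has_derivative_ident] sat_power_has_derivative[OF nz]]])
       (use pos in \<open>simp add: fun_eq_iff hx_def hz_def slope_den_def field_simps power2_eq_square\<close>)
  define F where "F = (\<lambda>p. (fst p, hodograph n (fst p) (snd p)))"
  define G where "G = (\<lambda>p. (fst p, sol n p))"
  have FG: "F (G p) = p" for p by (cases p) (simp add: F_def G_def)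
  have "(G has_derivative (\<lambda>p. (fst p, sol_slope_x n x z * fst p + sol_slope_y n x z * snd p))) (at (x, y))"
  proof (rule has_derivative_inverse_basic[where T = UNIV])
    show "(F has_derivative (\<lambda>p. (fst p, hx * fst p + hz * snd p))) (at (G (x, y)))"
      unfolding F_def G_def
      by (intro has_derivative_Pair has_derivative_fst has_derivative_ident) (simp add: dH flip: z_def)
    show "bounded_linear (\<lambda>p. (fst p, sol_slope_x n x z * fst p + sol_slope_y n x z * snd p))"
      by (intro bounded_linear_Pair bounded_linear_add bounded_linear_const_mult bounded_linear_fst bounded_linear_snd)
    have "sol_slope_x n x z + sol_slope_y n x z * hx = 0" "sol_slope_y n x z * hz = 1"
      using pos sat_pos[OF nz] by (simp_all add: sol_slope_x_def sol_slope_y_def hx_def hz_def field_simps)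
    then have "sol_slope_x n x z * a + sol_slope_y n x z * (hx * a + hz * b) = b" for a b
    proof -
      have "sol_slope_x n x z * a + sol_slope_y n x z * (hx * a + hz * b) = (sol_slope_x n x z + sol_slope_y n x z * hx) * a + sol_slope_y n x z * hz * b"
        by (simp add: algebra_simps)
      then show ?thesis by (simp add: \<open>sol_slope_x n x z + sol_slope_y n x z * hx = 0\<close> \<open>sol_slope_y n x z * hz = 1\<close>)
    qed
    then show "(\<lambda>p. (fst p, sol_slope_x n x z * fst p + sol_slope_y n x z * snd p)) \<circ> (\<lambda>p. (fst p, hx * fst p + hz * snd p)) = id"
      by (simp add: fun_eq_iff)
    show "continuous (at (x, y)) G"
      unfolding G_def using continuous_sol[of n]
      by (intro continuous_intros) (simp add: continuous_on_eq_continuous_at)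
  qed (auto simp: FG)
  from has_derivative_snd[OF this] show ?thesis by (simp add: G_def z_def)
qed

text \<open>This is \<open>-\<Phi>\<^sub>x(x, w)\<close>, the function conjugate to \<open>w\<close>.\<close>

definition stream :: "nat \<Rightarrow> real \<times> real \<Rightarrow> real" where
  "stream n = (\<lambda>(x, y). - x * sat x (sol n (x, y)) ^ n)"

text \<open>The two partial derivatives are \<open>-k w\<^sub>y\<close> and \<open>w\<^sub>x\<close>: this is the equation for \<open>w\<close> in first order form.\<close>

lemma stream_has_derivative:
  assumes "(x, y) \<noteq> 0"
  shows "(stream n has_derivative (\<lambda>p. - (coeff n x y (sol n (x, y)) * sol_slope_y n x (sol n (x, y))) * fst p
      + sol_slope_x n x (sol n (x, y)) * snd p)) (at (x, y))"
proof -
  define z where "z = sol n (x, y)"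
  have nz: "\<not> (x = 0 \<and> z = 0)" using assms sol_eq_0_iff[of n x y] by (auto simp: z_def zero_prod_def)
  define s where "s = x\<^sup>2 + z\<^sup>2"
  have s: "s > 0" using nz by (simp add: s_def sum_power2_gt_zero_iff)
  define t where "t = sat x z ^ n"
  have As: "slope_num x z = s * (1 + s)" "sat x z = s / (1 + s)" by (simp_all add: sat_def slope_num_def s_def add.assoc)
  note pos = slope_num_pos[OF nz] slope_den_pos[OF nz, of n] zero_less_power[OF sat_pos[OF nz], of n, folded t_def]
  have dG: "((\<lambda>p. (fst p, sol n p)) has_derivative
      (\<lambda>p. (fst p, sol_slope_x n x z * fst p + sol_slope_y n x z * snd p))) (at (x, y))"
    unfolding z_def by (intro has_derivative_Pair has_derivative_fst has_derivative_ident sol_has_derivative assms)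
  have "((\<lambda>p. sat (fst p) (snd p) ^ n) has_derivative
    (\<lambda>p. 2 * n * sat x z ^ n / slope_num x z * (x * fst p + z * snd p))) (at (fst (x, y), sol n (x, y)))"
    using sat_power_has_derivative[OF nz, of n] by (simp add: z_def)
  from has_derivative_compose[OF dG this]
  have dT: "((\<lambda>p. sat (fst p) (sol n p) ^ n) has_derivative
    (\<lambda>p. 2 * n * t / slope_num x z * (x * fst p + z * (sol_slope_x n x z * fst p + sol_slope_y n x z * snd p)))) (at (x, y))"
    by (simp add: t_def)
  have k: "coeff n x y z = t * t * ((1 + s + 2 * n) / (1 + s))"
  proof -
    have "1 + 2 * n * (1 - sat x z) = (1 + s + 2 * n) / (1 + s)"
      using s unfolding As(2) by (simp add: field_simps)
    moreover have "sat x z ^ (2 * n) = t * t" by (simp add: t_def mult_2 power_add)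
    ultimately show ?thesis unfolding coeff_def by simp
  qed
  have den: "slope_den n x z = s * (1 + s) + 2 * n * z\<^sup>2" by (simp add: slope_den_def As)
  have e1: "t + x * (2 * n * t / slope_num x z * (x + z * sol_slope_x n x z)) = coeff n x y z * sol_slope_y n x z"
  proof -
    have "x + z * sol_slope_x n x z = x * slope_num x z / slope_den n x z"
      using pos by (simp add: sol_slope_x_def slope_den_def field_simps power2_eq_square)
    then have "t + x * (2 * n * t / slope_num x z * (x + z * sol_slope_x n x z)) = t + x * (2 * n * t / slope_num x z * (x * slope_num x z / slope_den n x z))"
      by simp
    also have "\<dots> = t * (slope_den n x z + 2 * n * x\<^sup>2) / slope_den n x z"
      using pos by (simp add: field_simps power2_eq_square)
    also have "slope_den n x z + 2 * n * x\<^sup>2 = s * (1 + s + 2 * n)"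
      unfolding den by (simp add: s_def algebra_simps power2_eq_square)
    also have "t * (s * (1 + s + 2 * n)) / slope_den n x z = coeff n x y z * sol_slope_y n x z"
    proof -
      have "t * (s * E) / d = t * t * (E / c) * (s * c / (t * d))" if "c > 0" for E c d
        using that pos by (cases "d = 0") (simp_all add: field_simps)
      from this[of "1 + s"] show ?thesis
        unfolding k sol_slope_y_def t_def[symmetric] As(1) using s by simp
    qed
    finally show ?thesis .
  qed
  have e2: "- (x * (2 * n * t / slope_num x z * (z * sol_slope_y n x z))) = sol_slope_x n x z"
    unfolding sol_slope_y_def sol_slope_x_def t_def[symmetric] using pos by (simp add: field_simps)
  have "((\<lambda>p. - (fst p * sat (fst p) (sol n p) ^ n)) has_derivative
    (\<lambda>p. - (fst (x, y) * (2 * n * t / slope_num x z * (x * fst p + z * (sol_slope_x n x z * fst p + sol_slope_y n x z * snd p)))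
      + fst p * sat (fst (x, y)) (sol n (x, y)) ^ n))) (at (x, y))"
    by (intro has_derivative_minus has_derivative_mult has_derivative_fst has_derivative_ident dT)
  also have "(\<lambda>p. - (fst (x, y) * (2 * n * t / slope_num x z * (x * fst p + z * (sol_slope_x n x z * fst p + sol_slope_y n x z * snd p)))
      + fst p * sat (fst (x, y)) (sol n (x, y)) ^ n)) = (\<lambda>p. - (coeff n x y z * sol_slope_y n x z) * fst p + sol_slope_x n x z * snd p)"
  proof
    fix p :: "real \<times> real"
    have "- (fst (x, y) * (2 * n * t / slope_num x z * (x * fst p + z * (sol_slope_x n x z * fst p + sol_slope_y n x z * snd p)))
      + fst p * sat (fst (x, y)) (sol n (x, y)) ^ n) =
      - (t + x * (2 * n * t / slope_num x z * (x + z * sol_slope_x n x z))) * fst p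
      + (- (x * (2 * n * t / slope_num x z * (z * sol_slope_y n x z)))) * snd p"
      unfolding t_def z_def[symmetric] by (simp add: algebra_simps add_divide_distrib)
    then show "- (fst (x, y) * (2 * n * t / slope_num x z * (x * fst p + z * (sol_slope_x n x z * fst p + sol_slope_y n x z * snd p)))
      + fst p * sat (fst (x, y)) (sol n (x, y)) ^ n) = - (coeff n x y z * sol_slope_y n x z) * fst p + sol_slope_x n x z * snd p"
      unfolding e1 e2 .
  qed
  finally show ?thesis by (simp add: stream_def case_prod_unfold z_def)
qed

lemma sol_slope_x_bound: "\<bar>sol_slope_x n x z\<bar> \<le> n"
proof (cases "x = 0 \<and> z = 0")
  case False
  have "2 * \<bar>x * z\<bar> \<le> x\<^sup>2 + z\<^sup>2"
    using sum_squares_bound[of "\<bar>x\<bar>" "\<bar>z\<bar>"] by (simp add: abs_mult)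
  also have "\<dots> \<le> slope_num x z" unfolding slope_num_def by (simp add: mult_le_cancel_left1)
  also have "\<dots> \<le> slope_den n x z" by (rule slope_den_ge)
  finally have "n * (2 * \<bar>x * z\<bar>) \<le> n * slope_den n x z" by (rule mult_left_mono) simp
  then show ?thesis using slope_den_pos[OF False, of n] by (simp add: sol_slope_x_def abs_mult divide_simps mult_ac)
qed (simp add: sol_slope_x_def)

lemma sol_slope_y_nonneg: "0 \<le> sol_slope_y n x z"
  unfolding sol_slope_y_def slope_den_def slope_num_def using sat_nonneg[of x z] by (auto intro!: divide_nonneg_nonneg mult_nonneg_nonneg)

lemma sat_power_sol_slope_y_le: "sat x z ^ n * sol_slope_y n x z \<le> 1"
proof (cases "x = 0 \<and> z = 0")
  case False
  note pos = slope_num_pos[OF False] slope_den_pos[OF False, of n] zero_less_power[OF sat_pos[OF False], of n]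
  then show ?thesis using slope_den_ge[of x z n] by (simp add: sol_slope_y_def divide_simps)
qed (simp add: sol_slope_y_def slope_num_def)

lemma coeff_slope_bound: "\<bar>coeff n x y z * sol_slope_y n x z\<bar> \<le> 1 + 2 * real n"
proof -
  have unit: "0 \<le> sat x z ^ n" "sat x z ^ n \<le> 1" using sat_nonneg[of x z] sat_less_1[of x z] by (auto intro: power_le_one)
  have "coeff n x y z * sol_slope_y n x z \<le> ((1 + 2 * real n) * sat x z ^ (2 * n)) * sol_slope_y n x z"
    by (intro mult_right_mono coeff_le sol_slope_y_nonneg)
  also have "\<dots> = (1 + 2 * real n) * sat x z ^ n * (sat x z ^ n * sol_slope_y n x z)"
    by (simp only: mult_2[of n] power_add mult.assoc)
  also have "\<dots> \<le> (1 + 2 * real n) * sat x z ^ n * 1"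
    using unit sat_power_sol_slope_y_le by (intro mult_left_mono) auto
  also have "\<dots> \<le> (1 + 2 * real n) * 1" using unit by (simp add: mult_left_le)
  finally show ?thesis using coeff_nonneg[of n x y z] sol_slope_y_nonneg[of n x z] by (simp add: abs_of_nonneg)
qed

lemma sat_axis_le: "sat x 0 \<le> sat x z"
  using sat_mono[of 0 "\<bar>z\<bar>" x] by (simp add: sat_def)

text \<open>The weight in the second weak derivative is the coefficient at \<open>z = 0\<close>, whereas \<open>w\<^sub>y\<close> is controlled by
  \<open>t\<^bsup>-n\<^esup>\<close> at \<open>z = w\<close>. Monotonicity of \<open>t\<close> in \<open>\<bar>z\<bar>\<close> relates the two.\<close>

lemma sqrt_coeff_le: "sqrt (coeff n x y 0) \<le> (1 + 2 * real n) * sat x z ^ n"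
proof (rule real_le_lsqrt)
  have "coeff n x y 0 \<le> (1 + 2 * real n) * sat x 0 ^ (2 * n)" by (rule coeff_le)
  also have "\<dots> \<le> (1 + 2 * real n)\<^sup>2 * sat x z ^ (2 * n)"
    using sat_axis_le[of x z] sat_nonneg[of x 0]
    by (intro mult_mono power_mono) (auto simp: power2_eq_square)
  also have "\<dots> = ((1 + 2 * real n) * sat x z ^ n)\<^sup>2" by (simp add: power_mult_distrib power_even_eq mult.commute flip: power_mult)
  finally show "coeff n x y 0 \<le> ((1 + 2 * real n) * sat x z ^ n)\<^sup>2" .
qed (use sat_nonneg[of x z] in auto)

lemma sqrt_coeff_slope_bound: "\<bar>sqrt (coeff n x y 0) * sol_slope_y n x z\<bar> \<le> 1 + 2 * real n"
proof -
  have "sqrt (coeff n x y 0) * sol_slope_y n x z \<le> ((1 + 2 * real n) * sat x z ^ n) * sol_slope_y n x z"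
    by (intro mult_right_mono sqrt_coeff_le sol_slope_y_nonneg)
  also have "\<dots> = (1 + 2 * real n) * (sat x z ^ n * sol_slope_y n x z)" by simp
  also have "\<dots> \<le> (1 + 2 * real n) * 1" using sat_power_sol_slope_y_le by (intro mult_left_mono) auto
  finally show ?thesis using coeff_nonneg[of n x y 0] sol_slope_y_nonneg[of n x z] by (simp add: abs_of_nonneg)
qed

text \<open>A differentiable \<open>w\<close> would make the identity \<open>z = w(0, \<Phi>\<^sub>z(0, z))\<close> have derivative \<open>0\<close> at \<open>z = 0\<close>, by
  the chain rule, since the inner function has derivative \<open>0\<close> there when \<open>n \<ge> 1\<close>.\<close>

lemma not_smooth_sol:
  assumes n: "n \<ge> 1" and S: "(0, 0) \<in> S"
  shows "\<not> smooth_on S (sol n)"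
proof
  assume "smooth_on S (sol n)"
  then have "Ck_on (Suc 0) S (sol n)" unfolding smooth_on_def by blast
  then have "sol n differentiable (at (0, 0))" using S by auto
  then obtain w' where w': "(sol n has_derivative w') (at (0, 0))" by (auto simp: differentiable_def)
  have "((\<lambda>z. hodograph n 0 z) has_real_derivative 0) (at 0)"
    unfolding hodograph_def using n by (auto intro!: derivative_eq_intros sat_has_derivative_z simp: sat_0)
  then have "((\<lambda>z. hodograph n 0 z) has_derivative (\<lambda>h. 0)) (at 0)"
    by (simp add: has_field_derivative_def lambda_zero)
  then have dG: "((\<lambda>z. (0, hodograph n 0 z)) has_derivative (\<lambda>h. (0, 0))) (at 0)"
    by (intro has_derivative_Pair has_derivative_const)
  have "((\<lambda>z. sol n (0, hodograph n 0 z)) has_derivative (\<lambda>h. w' (0, 0))) (at 0)"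
    by (rule has_derivative_compose[OF dG]) (use w' in \<open>simp add: hodograph_def\<close>)
  moreover have "w' (0, 0) = 0"
    using linear_0[OF has_derivative_linear[OF w']] by (simp add: zero_prod_def)
  ultimately have "((\<lambda>z::real. z) has_derivative (\<lambda>h. 0)) (at 0)" by simp
  then have "(\<lambda>h::real. 0) = (\<lambda>h. h)" by (rule has_derivative_unique) (rule has_derivative_ident)
  then show False by (metis zero_neq_one)
qed

section \<open>From derivatives off the origin to weak derivatives\<close>

lemma partial_x_eqI: "(dquot f (1, 0) p \<longlongrightarrow> d) (at 0) \<Longrightarrow> partial_x f p = d"
  and partial_y_eqI: "(dquot f (0, 1) p \<longlongrightarrow> d) (at 0) \<Longrightarrow> partial_y f p = d"
  by (auto simp: partial_x_def partial_y_def dquot_def[abs_def] case_prod_unfold DERIV_def intro!: DERIV_imp_deriv)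
     (cases p; simp)+

lemma partial_AE:
  fixes u :: "real \<times> real \<Rightarrow> real"
  assumes "L-lipschitz_on UNIV u"
  shows "AE p in lborel. (dquot u (1, 0) p \<longlongrightarrow> partial_x u p) (at 0)"
    and "AE p in lborel. (dquot u (0, 1) p \<longlongrightarrow> partial_y u p) (at 0)"
proof -
  show "AE p in lborel. (dquot u (1, 0) p \<longlongrightarrow> partial_x u p) (at 0)"
    using lipschitz_AE_dquot_converges[OF assms, of "(1, 0)"] by (auto elim!: eventually_mono dest: partial_x_eqI)
  show "AE p in lborel. (dquot u (0, 1) p \<longlongrightarrow> partial_y u p) (at 0)"
    using lipschitz_AE_dquot_converges[OF assms, of "(0, 1)"] by (auto elim!: eventually_mono dest: partial_y_eqI)
qed

lemma Lip0_E:
  assumes "u \<in> Lip0 \<Omega>"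
  obtains L S where "L-lipschitz_on UNIV u" "S \<subseteq> \<Omega>" "test_function u S"
    "\<And>e p. p \<notin> S \<Longrightarrow> (dquot u e p \<longlongrightarrow> 0) (at 0)"
proof -
  obtain L where L: "L-lipschitz_on UNIV u" using assms by (auto simp: Lip0_def)
  define S where "S = closure {p. u p \<noteq> 0}"
  have S: "compact S" "S \<subseteq> \<Omega>" using assms by (auto simp: Lip0_def S_def)
  have z: "u p = 0" if "p \<notin> S" for p
    using that closure_subset[of "{p. u p \<noteq> 0}"] by (auto simp: S_def)
  have "(dquot u e p \<longlongrightarrow> 0) (at 0)" if p: "p \<notin> S" for e p
  proof -
    have "open (- S)" using S(1) by (simp add: compact_imp_closed open_Compl)
    moreover have "((\<lambda>h. p + h *\<^sub>R e) \<longlongrightarrow> p + 0 *\<^sub>R e) (at 0)" by (intro tendsto_intros)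
    ultimately have "eventually (\<lambda>h. p + h *\<^sub>R e \<in> - S) (at 0)"
      using topological_tendstoD[of "\<lambda>h. p + h *\<^sub>R e" p "at 0" "- S"] p by simp
    then have "eventually (\<lambda>h. dquot u e p h = 0) (at 0)"
      by eventually_elim (simp add: dquot_def z p)
    then show ?thesis by (rule tendsto_eventually)
  qed
  moreover have "test_function u S"
    using lipschitz_on_continuous_on[OF L] S z by unfold_locales auto
  ultimately show thesis using that L S by blast
qed

lemma integral_lebesgue_on_eq:
  fixes f :: "'a::euclidean_space \<Rightarrow> real"
  assumes "open \<Omega>" "\<And>x. x \<notin> \<Omega> \<Longrightarrow> f x = 0"
  shows "integrable (lebesgue_on \<Omega>) f \<longleftrightarrow> integrable lebesgue f"
    and "integral\<^sup>L (lebesgue_on \<Omega>) f = integral\<^sup>L lebesgue f"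
proof -
  have "(\<lambda>x. indicator \<Omega> x *\<^sub>R f x) = f" using assms(2) by (intro ext) (auto simp: indicator_def)
  then show "integrable (lebesgue_on \<Omega>) f \<longleftrightarrow> integrable lebesgue f"
    "integral\<^sup>L (lebesgue_on \<Omega>) f = integral\<^sup>L lebesgue f"
    using assms(1) by (simp_all add: integrable_restrict_space integral_restrict_space)
qed

text \<open>Measurability of \<open>g\<close> comes from completeness of the measure. This is needed for functions such as
  \<open>partial_y u\<close>, whose values on a null set are unspecified.\<close>

lemma lebesgue_integral_AE_eq:
  fixes f g :: "'a::euclidean_space \<Rightarrow> real"
  assumes f: "integrable lebesgue f" and ae: "AE x in lborel. f x = g x"
  shows "integral\<^sup>L lebesgue g = integral\<^sup>L lebesgue f"
proof -
  have ae': "AE x in lebesgue. f x = g x" using ae by (rule AE_completion)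
  have m: "f \<in> borel_measurable lebesgue" using f by simp
  have "g \<in> borel_measurable lebesgue" by (rule borel_measurable_AE[OF m ae'])
  then show ?thesis using m ae' by (intro integral_cong_AE) (auto elim: eventually_mono)
qed

lemma bounded_borel_integrable:
  fixes f :: "'a::euclidean_space \<Rightarrow> real"
  assumes f: "f \<in> borel_measurable borel" and S: "S \<in> lmeasurable"
    and B: "\<And>x. x \<in> S \<Longrightarrow> \<bar>f x\<bar> \<le> B"
  shows "integrable (lebesgue_on S) f"
proof -
  interpret finite_measure "lebesgue_on S"
    using S by (auto intro!: finite_measureI simp: emeasure_restrict_space space_restrict_space fmeasurable_def)
  have "f \<in> borel_measurable (lebesgue_on S)"
    using f by (intro measurable_restrict_space1 measurable_completion) simp
  then show ?thesis
    using B by (intro integrable_const_bound[where B = B]) (auto intro!: AE_I2 simp: space_restrict_space)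
qed

lemma locally_integrableI:
  assumes "f \<in> borel_measurable borel" "bounded \<Omega>" "\<And>x. x \<in> \<Omega> \<Longrightarrow> \<bar>f x\<bar> \<le> B"
  shows "locally_integrable \<Omega> f"
  unfolding locally_integrable_def
  using assms by (auto intro!: bounded_borel_integrable lmeasurable_compact)

lemma L2_onI:
  fixes f :: "real \<times> real \<Rightarrow> real"
  assumes f: "f \<in> borel_measurable borel" and \<Omega>: "open \<Omega>" "bounded \<Omega>" and B: "\<And>x. x \<in> \<Omega> \<Longrightarrow> \<bar>f x\<bar> \<le> B"
  shows "L2_on \<Omega> f"
  unfolding L2_on_def
proof
  show "f \<in> borel_measurable (lebesgue_on \<Omega>)"
    using f by (intro measurable_restrict_space1 measurable_completion) simp
  have "\<bar>(f x)\<^sup>2\<bar> \<le> B\<^sup>2" if "x \<in> \<Omega>" for x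
    using power_mono[OF B[OF that], of 2] by simp
  then show "integrable (lebesgue_on \<Omega>) (\<lambda>p. (f p)\<^sup>2)"
    using f \<Omega> by (intro bounded_borel_integrable[where B = "B\<^sup>2"] lmeasurable_open) auto
qed

definition sol_x :: "nat \<Rightarrow> real \<times> real \<Rightarrow> real" where "sol_x n p = sol_slope_x n (fst p) (sol n p)"
definition sol_y :: "nat \<Rightarrow> real \<times> real \<Rightarrow> real" where "sol_y n p = sol_slope_y n (fst p) (sol n p)"

lemma sol_borel [measurable]: "sol n \<in> borel_measurable borel"
  using continuous_sol by (rule borel_measurable_continuous_onI)

lemma fst_borel [measurable]: "(fst :: real \<times> real \<Rightarrow> real) \<in> borel_measurable borel"
  by (intro borel_measurable_continuous_onI continuous_intros)

lemma sol_x_borel [measurable]: "sol_x n \<in> borel_measurable borel"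
  unfolding sol_x_def[abs_def] sol_slope_x_def slope_den_def slope_num_def by measurable

lemma sol_y_borel [measurable]: "sol_y n \<in> borel_measurable borel"
  unfolding sol_y_def[abs_def] sol_slope_y_def slope_den_def slope_num_def sat_def by measurable

lemma sol_dquot:
  assumes "p \<noteq> 0"
  shows "(dquot (sol n) (1, 0) p \<longlongrightarrow> sol_x n p) (at 0)" "(dquot (sol n) (0, 1) p \<longlongrightarrow> sol_y n p) (at 0)"
  using has_derivative_dquot[OF sol_has_derivative[of "fst p" "snd p" n], of "(1, 0)"]
    has_derivative_dquot[OF sol_has_derivative[of "fst p" "snd p" n], of "(0, 1)"] assms
  by (simp_all add: sol_x_def sol_y_def)

lemma stream_dquot:
  assumes "p \<noteq> 0"
  shows "(dquot (stream n) (1, 0) p \<longlongrightarrow> - (coeff n (fst p) (snd p) (sol n p) * sol_y n p)) (at 0)"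
    and "(dquot (stream n) (0, 1) p \<longlongrightarrow> sol_x n p) (at 0)"
  using has_derivative_dquot[OF stream_has_derivative[of "fst p" "snd p" n], of "(1, 0)"]
    has_derivative_dquot[OF stream_has_derivative[of "fst p" "snd p" n], of "(0, 1)"] assms
  by (simp_all add: sol_x_def sol_y_def)

lemma sol_x_bound: "\<bar>sol_x n p\<bar> \<le> n"
  unfolding sol_x_def by (rule sol_slope_x_bound)

lemma continuous_stream: "continuous_on UNIV (stream n)"
proof -
  have "continuous_on UNIV (\<lambda>p. - fst p * sat (fst p) (sol n p) ^ n)"
    by (intro continuous_intros continuous_sol)
  then show ?thesis by (simp add: stream_def case_prod_unfold)
qed

lemma AE_not_0: "(\<And>p :: 'a::euclidean_space. p \<noteq> 0 \<Longrightarrow> P p) \<Longrightarrow> AE p in lborel. P p"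
  using AE_lborel_singleton[of "0::'a"] by (auto elim: eventually_mono)

lemma sol_bounded:
  assumes "bounded \<Omega>"
  obtains B where "\<And>p. p \<in> \<Omega> \<Longrightarrow> \<bar>sol n p\<bar> \<le> B"
proof -
  have "compact (sol n ` closure \<Omega>)"
    using assms by (intro compact_continuous_image continuous_on_subset[OF continuous_sol]) auto
  then obtain B where "\<forall>x \<in> sol n ` closure \<Omega>. norm x \<le> B" using compact_imp_bounded bounded_iff by metis
  then show thesis using closure_subset[of \<Omega>] by (intro that[of B]) auto
qed

text \<open>The first weak derivative is integration by parts against \<open>w\<close>, the second against \<open>\<surd>k(x,0) w\<close>, which
  unlike \<open>w\<close> is Lipschitz in \<open>y\<close>. The equation itself is the symmetry of the mixed derivatives of \<open>u\<close> and
  the stream function.\<close>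

lemma weak_solution_sol:
  assumes \<Omega>: "open \<Omega>" "bounded \<Omega>"
  shows "weak_solution \<Omega> (coeff n) (sol n)"
proof -
  obtain B where B: "\<And>p. p \<in> \<Omega> \<Longrightarrow> \<bar>sol n p\<bar> \<le> B" using sol_bounded[OF \<Omega>(2), of n] by blast
  define a where "a = (\<lambda>p :: real \<times> real. sqrt (coeff n (fst p) (snd p) 0))"
  define g2 where "g2 = (\<lambda>p. a p * sol_y n p)"
  \<comment> \<open>The weight does not depend on \<open>y\<close>, so it commutes with difference quotients in \<open>y\<close>.\<close>
  have a_shift: "a (p + h *\<^sub>R (0, 1)) = a p" for p h by (simp add: a_def coeff_def)
  have a_cont: "continuous_on UNIV a"
    unfolding a_def coeff_def by (intro continuous_intros)
  have g2_bound: "\<bar>g2 p\<bar> \<le> 1 + 2 * real n" for p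
    unfolding g2_def a_def sol_y_def by (rule sqrt_coeff_slope_bound)
  have kgy_bound: "\<bar>coeff n (fst p) (snd p) (sol n p) * sol_y n p\<bar> \<le> 1 + 2 * real n" for p
    unfolding sol_y_def by (rule coeff_slope_bound)
  have [measurable]: "a \<in> borel_measurable borel" by (rule borel_measurable_continuous_onI[OF a_cont])
  have g2_borel [measurable]: "g2 \<in> borel_measurable borel" unfolding g2_def by measurable

  have wx: "\<bar>sol n (p + h *\<^sub>R (1, 0)) - sol n p\<bar> \<le> real n * \<bar>h\<bar>" for p h
    by (rule bounded_dquot_lipschitz[OF continuous_sol _ sol_dquot(1)]) (auto simp: sol_x_bound)
  have aw_cont: "continuous_on UNIV (\<lambda>p. a p * sol n p)"
    by (intro continuous_intros a_cont continuous_sol)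
  have aw_lim: "(dquot (\<lambda>p. a p * sol n p) (0, 1) p \<longlongrightarrow> g2 p) (at 0)" if "p \<noteq> 0" for p
  proof -
    have "dquot (\<lambda>p. a p * sol n p) (0, 1) p = (\<lambda>h. a p * dquot (sol n) (0, 1) p h)"
      unfolding dquot_def a_shift by (simp add: fun_eq_iff algebra_simps diff_divide_distrib)
    then show ?thesis unfolding g2_def using sol_dquot(2)[OF that] by (auto intro: tendsto_intros)
  qed
  have awy: "\<bar>a (p + h *\<^sub>R (0, 1)) * sol n (p + h *\<^sub>R (0, 1)) - a p * sol n p\<bar> \<le> (1 + 2 * real n) * \<bar>h\<bar>" for p h
    by (rule bounded_dquot_lipschitz[OF aw_cont _ aw_lim]) (auto simp: g2_bound)
  have stream_x: "\<bar>stream n (p + h *\<^sub>R (1, 0)) - stream n p\<bar> \<le> (1 + 2 * real n) * \<bar>h\<bar>" for p h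
    by (rule bounded_dquot_lipschitz[OF continuous_stream _ stream_dquot(1)]) (use kgy_bound in auto)
  have stream_y: "\<bar>stream n (p + h *\<^sub>R (0, 1)) - stream n p\<bar> \<le> real n * \<bar>h\<bar>" for p h
    by (rule bounded_dquot_lipschitz[OF continuous_stream _ stream_dquot(2)]) (auto simp: sol_x_bound)

  have weak_x: "is_weak_derivative \<Omega> partial_x (\<lambda>(x, y). sqrt 1) (sol n) (sol_x n)"
    unfolding is_weak_derivative_def
  proof (intro conjI ballI)
    show "locally_integrable \<Omega> (sol n)" using B \<Omega> by (intro locally_integrableI) auto
    show "locally_integrable \<Omega> (sol_x n)" using sol_x_bound \<Omega> by (intro locally_integrableI) auto
    fix \<phi> assume "\<phi> \<in> Lip0 \<Omega>"
    then obtain L S where L: "L-lipschitz_on UNIV \<phi>" and S_sub: "S \<subseteq> \<Omega>"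
      and tf: "test_function \<phi> S" and off: "\<And>e p. p \<notin> S \<Longrightarrow> (dquot \<phi> e p \<longlongrightarrow> 0) (at 0)"
      by (rule Lip0_E) blast
    interpret test_function \<phi> S by (fact tf)
    have px0: "partial_x \<phi> p = 0" if "p \<notin> \<Omega>" for p
      using off[of p] that S_sub by (intro partial_x_eqI) auto
    have z: "\<phi> p = 0" if "p \<notin> \<Omega>" for p using supp[of p] that S_sub by auto
    note ibp = integration_by_parts[OF lipschitz_dquot_bound[OF L] continuous_sol wx
        partial_AE(1)[OF L] AE_not_0[OF sol_dquot(1)]]
    have "(LINT p|lebesgue_on \<Omega>. sol_x n p * \<phi> p) = (\<integral>p. \<phi> p * sol_x n p \<partial>lebesgue)"
      using \<Omega>(1) z by (subst integral_lebesgue_on_eq(2)) (auto simp: mult.commute)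
    also have "\<dots> = - (\<integral>p. partial_x \<phi> p * sol n p \<partial>lebesgue)" using ibp(3) by simp
    also have "(\<integral>p. partial_x \<phi> p * sol n p \<partial>lebesgue) = (LINT p|lebesgue_on \<Omega>. sol n p * partial_x \<phi> p)"
      using \<Omega>(1) px0 by (subst integral_lebesgue_on_eq(2)) (auto simp: mult.commute)
    finally show "(LINT p|lebesgue_on \<Omega>. sol_x n p * \<phi> p) =
        - (LINT p|lebesgue_on \<Omega>. sol n p * partial_x (\<lambda>q. (case q of (x, y) \<Rightarrow> sqrt 1) * \<phi> q) p)"
      by (simp add: case_prod_unfold)
  qed
  have weak_y: "is_weak_derivative \<Omega> partial_y (\<lambda>(x, y). sqrt (coeff n x y 0)) (sol n) g2"
    unfolding is_weak_derivative_def
  proof (intro conjI ballI)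
    show "locally_integrable \<Omega> (sol n)" using B \<Omega> by (intro locally_integrableI) auto
    show "locally_integrable \<Omega> g2" using g2_bound \<Omega> by (intro locally_integrableI) auto
    fix \<phi> assume "\<phi> \<in> Lip0 \<Omega>"
    then obtain L S where L: "L-lipschitz_on UNIV \<phi>" and S_sub: "S \<subseteq> \<Omega>"
      and tf: "test_function \<phi> S" and off: "\<And>e p. p \<notin> S \<Longrightarrow> (dquot \<phi> e p \<longlongrightarrow> 0) (at 0)"
      by (rule Lip0_E) blast
    interpret test_function \<phi> S by (fact tf)
    have pull: "partial_y (\<lambda>q. a q * \<phi> q) p = a p * d" if "(dquot \<phi> (0, 1) p \<longlongrightarrow> d) (at 0)" for p d
    proof (rule partial_y_eqI)
      have "dquot (\<lambda>q. a q * \<phi> q) (0, 1) p = (\<lambda>h. a p * dquot \<phi> (0, 1) p h)"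
        unfolding dquot_def a_shift by (simp add: fun_eq_iff algebra_simps diff_divide_distrib)
      then show "(dquot (\<lambda>q. a q * \<phi> q) (0, 1) p \<longlongrightarrow> a p * d) (at 0)"
        using that by (auto intro: tendsto_intros)
    qed
    have py0: "partial_y (\<lambda>q. a q * \<phi> q) p = 0" if "p \<notin> \<Omega>" for p
      using pull[OF off[of p]] that S_sub by auto
    have z: "\<phi> p = 0" if "p \<notin> \<Omega>" for p using supp[of p] that S_sub by auto
    note ibp = integration_by_parts[OF lipschitz_dquot_bound[OF L] aw_cont awy
        partial_AE(2)[OF L] AE_not_0[OF aw_lim]]
    \<comment> \<open>Where \<open>\<phi>\<close> is not differentiable, the weight need not come out of the unspecified derivative.\<close>
    have ae: "AE p in lborel. partial_y \<phi> p * (a p * sol n p) = sol n p * partial_y (\<lambda>q. a q * \<phi> q) p"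
      using partial_AE(2)[OF L] by eventually_elim (simp add: pull)
    have "(LINT p|lebesgue_on \<Omega>. g2 p * \<phi> p) = (\<integral>p. \<phi> p * g2 p \<partial>lebesgue)"
      using \<Omega>(1) z by (subst integral_lebesgue_on_eq(2)) (auto simp: mult.commute)
    also have "\<dots> = - (\<integral>p. partial_y \<phi> p * (a p * sol n p) \<partial>lebesgue)" using ibp(3) by simp
    also have "(\<integral>p. partial_y \<phi> p * (a p * sol n p) \<partial>lebesgue)
        = (\<integral>p. sol n p * partial_y (\<lambda>q. a q * \<phi> q) p \<partial>lebesgue)"
      by (rule lebesgue_integral_AE_eq[OF ibp(1) ae, symmetric])
    also have "\<dots> = (LINT p|lebesgue_on \<Omega>. sol n p * partial_y (\<lambda>q. a q * \<phi> q) p)"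
      using \<Omega>(1) py0 by (subst integral_lebesgue_on_eq(2)) auto
    finally show "(LINT p|lebesgue_on \<Omega>. g2 p * \<phi> p) =
        - (LINT p|lebesgue_on \<Omega>. sol n p * partial_y (\<lambda>q. (case q of (x, y) \<Rightarrow> sqrt (coeff n x y 0)) * \<phi> q) p)"
      by (simp add: case_prod_unfold a_def)
  qed
  have eqn: "integrable (lebesgue_on \<Omega>) (\<lambda>p. partial_x u p * sol_x n p + partial_y u p * coeff n (fst p) (snd p) (sol n p) * sol_y n p) \<and>
     (LINT p|lebesgue_on \<Omega>. partial_x u p * sol_x n p + partial_y u p * coeff n (fst p) (snd p) (sol n p) * sol_y n p) = 0"
    if u: "u \<in> Lip0 \<Omega>" for u
  proof -
    obtain L S where L: "L-lipschitz_on UNIV u" and S_sub: "S \<subseteq> \<Omega>"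
      and tf: "test_function u S" and off: "\<And>e p. p \<notin> S \<Longrightarrow> (dquot u e p \<longlongrightarrow> 0) (at 0)"
      using u by (rule Lip0_E) blast
    interpret test_function u S by (fact tf)
    have p0: "partial_x u p = 0" "partial_y u p = 0" if "p \<notin> \<Omega>" for p
      using off[of p] that S_sub by (auto intro!: partial_x_eqI partial_y_eqI)
    note md = mixed_derivatives[OF lipschitz_dquot_bound[OF L] lipschitz_dquot_bound[OF L]
        continuous_stream stream_x stream_y partial_AE[OF L] AE_not_0[OF stream_dquot(1)] AE_not_0[OF stream_dquot(2)]]
    have i: "integrable lebesgue (\<lambda>p. partial_y u p * coeff n (fst p) (snd p) (sol n p) * sol_y n p)"
      using integrable_minus[OF md(2)] by (simp add: mult.assoc)
    have "(\<integral>p. partial_x u p * sol_x n p + partial_y u p * coeff n (fst p) (snd p) (sol n p) * sol_y n p \<partial>lebesgue)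
        = (\<integral>p. partial_x u p * sol_x n p \<partial>lebesgue) + (\<integral>p. partial_y u p * coeff n (fst p) (snd p) (sol n p) * sol_y n p \<partial>lebesgue)"
      by (rule Bochner_Integration.integral_add[OF md(1) i])
    also have "\<dots> = 0" using md(3) by (simp add: mult.assoc)
    finally have "(\<integral>p. partial_x u p * sol_x n p + partial_y u p * coeff n (fst p) (snd p) (sol n p) * sol_y n p \<partial>lebesgue) = 0" .
    then show ?thesis
      using Bochner_Integration.integrable_add[OF md(1) i] p0 \<Omega>(1) by (simp add: integral_lebesgue_on_eq)
  qed
  have "(\<lambda>p. (sol_x n p, sol_y n p)) \<in> borel_measurable (lebesgue_on \<Omega>)"
  proof -
    have "(\<lambda>p. (sol_x n p, sol_y n p)) \<in> borel_measurable borel" by measurable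
    then show ?thesis by (intro measurable_restrict_space1 measurable_completion) simp
  qed
  moreover have "L2_on \<Omega> (sol n)" "L2_on \<Omega> (sol_x n)" "L2_on \<Omega> g2"
    using B sol_x_bound g2_bound \<Omega> by (auto intro!: L2_onI)
  moreover have "Linf_loc_on \<Omega> (sol n)"
    unfolding Linf_loc_on_def
  proof (intro conjI allI impI)
    show "sol n \<in> borel_measurable (lebesgue_on \<Omega>)"
      by (intro measurable_restrict_space1 measurable_completion) simp
    show "\<exists>M. AE p in lebesgue_on K. \<bar>sol n p\<bar> \<le> M" if "compact K \<and> K \<subseteq> \<Omega>" for K
      using B that by (intro exI[of _ B]) (auto intro!: AE_I2 simp: space_restrict_space)
  qed
  ultimately show ?thesis
    unfolding weak_solution_def
    using weak_x weak_y eqn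
    by (intro conjI exI[of _ "sol_x n"] exI[of _ g2] exI[of _ "\<lambda>p. (sol_x n p, sol_y n p)"])
       (auto simp: g2_def a_def case_prod_unfold)
qed

theorem mainTheorem8:
  fixes \<epsilon> :: real
  assumes "\<epsilon> > 0"
  shows "\<exists>k :: real \<Rightarrow> real \<Rightarrow> real \<Rightarrow> real.
    smooth_on UNIV (\<lambda>(x, y, z). k x y z) \<and>
    (\<forall>x y z. 0 \<le> k x y z) \<and>
    (\<forall>z y a b. a < b \<longrightarrow> (\<exists>x\<in>{a..b}. k x y z \<noteq> 0)) \<and>
    (\<forall>x y z. \<not> (x = 0 \<and> z = 0) \<longrightarrow> 0 < k x y z) \<and>
    (\<forall>\<Omega> :: (real \<times> real) set. open \<Omega> \<and> bounded \<Omega> \<and> (0, 0) \<in> \<Omega> \<longrightarrow>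
       (\<exists>C. \<forall>(x, y)\<in>\<Omega>. \<forall>z. \<bar>deriv (\<lambda>s. k x y s) z\<bar> \<le> C * k x y z powr (1 - \<epsilon>)) \<and>
       (\<exists>w :: real \<times> real \<Rightarrow> real.
          continuous_on \<Omega> w \<and> weak_solution \<Omega> k w \<and> \<not> smooth_on \<Omega> w))"
proof -
  obtain m :: nat where m: "1 / (4 * \<epsilon>) \<le> m" using real_arch_simple by blast
  \<comment> \<open>The successor ensures \<open>n \<ge> 1\<close> when \<open>\<epsilon>\<close> is large.\<close>
  define n where "n = Suc m"
  have n: "n \<ge> 1" by (simp add: n_def)
  have "1 \<le> 4 * \<epsilon> * m" using m assms by (simp add: field_simps)
  then have n\<epsilon>: "4 * n * \<epsilon> \<ge> 1" using assms by (simp add: n_def algebra_simps)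
  have seg: "\<exists>x\<in>{a..b}. coeff n x y z \<noteq> 0" if "a < b" for y z a b
  proof (cases "a = 0")
    case True
    then show ?thesis using that coeff_pos[of b z n y] by (intro bexI[of _ b]) auto
  next
    case False
    then show ?thesis using that coeff_pos[of a z n y] by (intro bexI[of _ a]) auto
  qed
  show ?thesis
  proof (intro exI[of _ "coeff n"] conjI allI impI smooth_coeff coeff_nonneg coeff_pos seg)
    fix \<Omega> :: "(real \<times> real) set"
    assume \<Omega>: "open \<Omega> \<and> bounded \<Omega> \<and> (0, 0) \<in> \<Omega>"
    show "\<exists>C. \<forall>(x, y)\<in>\<Omega>. \<forall>z. \<bar>deriv (\<lambda>s. coeff n x y s) z\<bar> \<le> C * coeff n x y z powr (1 - \<epsilon>)"
      using coeff_deriv_powr[OF n n\<epsilon>] by blast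
    show "\<exists>w. continuous_on \<Omega> w \<and> weak_solution \<Omega> (coeff n) w \<and> \<not> smooth_on \<Omega> w"
      using \<Omega> weak_solution_sol[of \<Omega> n] not_smooth_sol[OF n, of \<Omega>] continuous_on_subset[OF continuous_sol]
      by (intro exI[of _ "sol n"]) auto
  qed auto
qed

end
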